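(* Let $X$ be a finite set with $|X|=n$, and let $a\in\mathcal T_X$ be an idempotent with $r=\operatorname{rank}(a)$, where $1<r<n$. Let $A_1,\dots,A_r$ be the $\ker(a)$-classes, $\lambda_i=|A_i|$ and $\Lambda=\lambda_1\cdots\lambda_r$. Let $\mathcal E_X^a$ be the subsemigroup of $\mathcal T_X^a$ generated by all idempotents of $\mathcal T_X^a$. The number of idempotent generating sets of $\mathcal E_X^a$ of the minimal possible size $r^{n-r}+\rho_r$ is equal to $$\big[(r-1)^{n-r}\Lambda\big]^{\rho_r}\,\Lambda!\,S(r^{n-r},\Lambda)\sum_{\Gamma\in\mathbb T_r}\frac{1}{\lambda_1^{d_\Gamma^+(1)}\cdots\lambda_r^{d_\Gamma^+(r)}}.$$
   Context: $\mathcal T_X$ is the full transformation semigroup of all maps $X\to X$ under composition; maps are written on the right and composed from left to right; $\operatorname{rank}(f)=|\operatorname{im}(f)|$ and $\ker(f)=\{(x,y):xf=yf\}$. The variant $\mathcal T_X^a$ is the semigroup with underlying set $\mathcal T_X$ and operation $f\star g=fag$. An idempotent generating set of $\mathcal E_X^a$ is a set of idempotents of $\mathcal T_X^a$ (elements with $f\star f=f$) that generates $\mathcal E_X^a$ as a semigroup under $\star$. $\rho_2=2$ and $\rho_r=\binom r2$ for $r\ge3$. $S(x,y)$ is the Stirling number of the second kind. A tournament on a set $Y$ is a directed graph with vertex set $Y$ containing, for each pair of distinct $x,y\in Y$, precisely one of the directed edges $(x,y)$, $(y,x)$; a directed graph is strongly connected if for any two vertices $x,y$ there is a directed path from $x$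 to $y$. For $r\ge3$, $\mathbb T_r$ is the set of all strongly connected tournaments on $\{1,\dots,r\}$; by convention $\mathbb T_2$ consists of the single directed graph on $\{1,2\}$ with edges $(1,2)$ and $(2,1)$. $d_\Gamma^+(j)$ is the in-degree of vertex $j$ in $\Gamma$, i.e. the number of edges of the form $(i,j)$. *)

theory Defs
  imports Complex_Main "HOL-Combinatorics.Stirling" "Graph_Theory.Graph_Theory"
begin

text \<open>
  The base set is the universe of a type of class \<open>finite\<close>, so that
  \<open>'a \<Rightarrow> 'a\<close> is the full transformation semigroup. Maps are composed
  from left to right: \<open>fg\<close> is first \<open>f\<close>, then \<open>g\<close>.
\<close>

definition trans_mult :: "('a \<Rightarrow> 'a) \<Rightarrow> ('a \<Rightarrow> 'a) \<Rightarrow> ('a \<Rightarrow> 'a)" where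
  "trans_mult f g = g \<circ> f"

definition trans_rank :: "('a \<Rightarrow> 'a) \<Rightarrow> nat" where
  "trans_rank f = card (range f)"

definition trans_ker :: "('a \<Rightarrow> 'a) \<Rightarrow> 'a rel" where
  "trans_ker f = {(x, y). f x = f y}"

definition variant_mult :: "('a \<Rightarrow> 'a) \<Rightarrow> ('a \<Rightarrow> 'a) \<Rightarrow> ('a \<Rightarrow> 'a) \<Rightarrow> ('a \<Rightarrow> 'a)" where
  "variant_mult a f g = trans_mult (trans_mult f a) g"

definition idempotents :: "('s \<Rightarrow> 's \<Rightarrow> 's) \<Rightarrow> 's set" where
  "idempotents m = {e. m e e = e}"

inductive_set subsemigroup_generated :: "('s \<Rightarrow> 's \<Rightarrow> 's) \<Rightarrow> 's set \<Rightarrow> 's set"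
  for m :: "'s \<Rightarrow> 's \<Rightarrow> 's" and S :: "'s set" where
  generator: "x \<in> S \<Longrightarrow> x \<in> subsemigroup_generated m S"
| product: "x \<in> subsemigroup_generated m S \<Longrightarrow> y \<in> subsemigroup_generated m S
    \<Longrightarrow> m x y \<in> subsemigroup_generated m S"

definition idem_subsemigroup :: "('a \<Rightarrow> 'a) \<Rightarrow> ('a \<Rightarrow> 'a) set" where
  "idem_subsemigroup a =
     subsemigroup_generated (variant_mult a) (idempotents (variant_mult a))"

definition idem_generating_set :: "('a \<Rightarrow> 'a) \<Rightarrow> ('a \<Rightarrow> 'a) set \<Rightarrow> bool" where
  "idem_generating_set a G \<longleftrightarrow>
     G \<subseteq> idempotents (variant_mult a) \<and>
     subsemigroup_generated (variant_mult a) G = idem_subsemigroup a"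

text \<open>Only the values at \<open>r \<ge> 2\<close> are meaningful.\<close>

definition rho :: "nat \<Rightarrow> nat" where
  "rho r = (if r = 2 then 2 else r choose 2)"

definition tournament :: "'v set \<Rightarrow> 'v pair_pre_digraph \<Rightarrow> bool" where
  "tournament Y \<Gamma> \<longleftrightarrow>
     pair_loopfree_digraph \<Gamma> \<and> pverts \<Gamma> = Y \<and>
     (\<forall>x\<in>Y. \<forall>y\<in>Y. x \<noteq> y \<longrightarrow> ((x, y) \<in> parcs \<Gamma>) \<noteq> ((y, x) \<in> parcs \<Gamma>))"

text \<open>
  For \<open>r = 2\<close> there is no strongly connected tournament; by convention the
  family then consists of the directed 2-cycle. Only \<open>r \<ge> 2\<close> is meaningful.
\<close>

definition strong_tournaments :: "nat \<Rightarrow> nat pair_pre_digraph set" where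
  "strong_tournaments r =
     (if r = 2 then {\<lparr>pverts = {1, 2}, parcs = {(1, 2), (2, 1)}\<rparr>}
      else {\<Gamma>. tournament {1..r} \<Gamma> \<and> strongly_connected (with_proj \<Gamma>)})"

end

theory Submission
  imports Defs "HOL-Library.FuncSet" "HOL-Combinatorics.Cycles"
begin

text \<open>
  An idempotent \<open>a\<close> factors as \<open>rep \<circ> idx\<close> through the index set \<open>I = {1..r}\<close> of its kernel classes. Sending
  \<open>f\<close> to its shadow \<open>i \<mapsto> idx (f (rep i))\<close> is a homomorphism from the variant to the self-maps of \<open>I\<close>. It
  maps idempotents to idempotents, and the fiber of idempotents over an idempotent \<open>\<theta>\<close> is counted by
  choosing a kernel and an image: \<open>card (\<theta> ` I) ^ (n - r)\<close> kernels, and one point in each class whose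
  index lies in \<open>\<theta> ` I\<close> (\<open>card_fiber\<close>).

  The fiber over the identity is a rectangular band with \<open>r ^ (n - r)\<close> kernels and \<open>Lam\<close> images, where
  \<open>Lam\<close> does not exceed the number of kernels. All other idempotents have singular shadows, so a generating set must
  generate the band from its own elements in the band, which means that it meets every kernel and
  every image. Multiplying on both sides by the band carries an idempotent of the variant to
  every idempotent with the same shadow (\<open>idempotent_factorization\<close>); hence for the remaining
  idempotents only the shadows matter, and these have to generate all singular self-maps of \<open>I\<close>.

  By Howie's theorem the latter are generated by the idempotents that move one point \<open>j\<close> to \<open>i\<close>, which
  are viewed as arcs \<open>(i, j)\<close>. A set of singular idempotents generates all singular self-maps exactly if the
  arcs in it form a strongly connected digraph with an arc between any two points: a product of defect
  one has a single missing point, which its factors push along a walk. The smallest such digraphs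
  have \<open>rho r\<close> arcs and are the members of \<open>strong_tournaments r\<close>. Together this is the criterion
  \<open>generates_iff\<close>.

  A generating set of minimal size thus consists of one element of the band for each kernel, that is, of a
  surjection from kernels to images, and of one idempotent over each arc of a digraph \<open>\<Gamma>\<close>. An arc with
  head \<open>j\<close> has \<open>(r - 1) ^ (n - r) * Lam / lam j\<close> idempotents over it, and multiplying over the arcs gives
  the summand of \<open>\<Gamma>\<close>.
\<close>

section \<open>Self-maps generated by idempotents of defect one\<close>

text \<open>The subsemigroup generated under composition of functions.\<close>

abbreviation generated_maps :: "('i \<Rightarrow> 'i) set \<Rightarrow> ('i \<Rightarrow> 'i) set" where
  "generated_maps \<equiv> subsemigroup_generated trans_mult"

text \<open>
  The full transformation semigroup on a subset \<open>I\<close> of a type, its elements extended by the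
  identity outside \<open>I\<close> so that they compose as ordinary functions.
\<close>

definition self_maps :: "'i set \<Rightarrow> ('i \<Rightarrow> 'i) set" where
  "self_maps I = {f. f ` I \<subseteq> I \<and> (\<forall>x. x \<notin> I \<longrightarrow> f x = x)}"

text \<open>
  The idempotent of defect one attached to an arc \<open>(i, j)\<close>: it moves \<open>j\<close> to \<open>i\<close> and fixes
  everything else, so the head \<open>j\<close> of the arc is the point missing from its image.
\<close>

definition collapse :: "'i \<times> 'i \<Rightarrow> 'i \<Rightarrow> 'i" where
  "collapse p = id(snd p := fst p)"

lemma collapse_apply: "collapse (i, j) x = (if x = j then i else x)"
  by (simp add: collapse_def)

lemma collapse_inject:
  assumes "i \<noteq> j" "collapse (i, j) = collapse (k, l)"
  shows "(i, j) = (k, l)"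
  using assms by (metis collapse_apply)

lemma collapse_idem: "i \<noteq> j \<Longrightarrow> collapse (i, j) (collapse (i, j) x) = collapse (i, j) x"
  by (simp add: collapse_apply)

lemma collapse_self_maps: "i \<in> I \<Longrightarrow> j \<in> I \<Longrightarrow> collapse (i, j) \<in> self_maps I"
  by (auto simp: self_maps_def collapse_apply)

lemma collapse_image: "i \<in> I \<Longrightarrow> j \<in> I \<Longrightarrow> i \<noteq> j \<Longrightarrow> collapse (i, j) ` I = I - {j}"
  by (auto simp: collapse_apply image_iff)

lemma collapse_not_inj: "i \<in> I \<Longrightarrow> j \<in> I \<Longrightarrow> i \<noteq> j \<Longrightarrow> \<not> inj_on (collapse (i, j)) I"
  by (auto simp: inj_on_def collapse_apply)

lemma self_maps_comp: "f \<in> self_maps I \<Longrightarrow> g \<in> self_maps I \<Longrightarrow> g \<circ> f \<in> self_maps I"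
  by (auto simp: self_maps_def image_subset_iff)

lemma generated_subset:
  assumes "M \<subseteq> subsemigroup_generated m N" "f \<in> subsemigroup_generated m M"
  shows "f \<in> subsemigroup_generated m N"
  using assms(2,1)
  by (induction rule: subsemigroup_generated.induct) (auto intro: subsemigroup_generated.product)

lemma generated_mono:
  "M \<subseteq> N \<Longrightarrow> subsemigroup_generated m M \<subseteq> subsemigroup_generated m N"
  by (meson generated_subset subsemigroup_generated.generator subset_iff)

lemma generated_comp:
  "f \<in> generated_maps M \<Longrightarrow> g \<in> generated_maps M \<Longrightarrow> g \<circ> f \<in> generated_maps M"
  using subsemigroup_generated.product[of f trans_mult M g] by (simp add: trans_mult_def)

lemma generated_funpow:
  assumes "f \<in> generated_maps M" "n > 0"
  shows "f ^^ n \<in> generated_maps M"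
  using assms(2)
proof (induction n rule: nat_induct_non_zero)
  case 1
  show ?case using assms(1) by (simp add: eq_id_iff)
next
  case (Suc n)
  then show ?case using generated_comp[OF Suc.IH assms(1)] by (simp add: o_def)
qed

lemma generated_singular:
  assumes "f \<in> generated_maps M" "M \<subseteq> self_maps I" "\<And>m. m \<in> M \<Longrightarrow> \<not> inj_on m I"
  shows "f \<in> self_maps I \<and> \<not> inj_on f I"
  using assms(1)
proof (induction rule: subsemigroup_generated.induct)
  case (generator x)
  then show ?case using assms by auto
next
  case (product x y)
  then show ?case unfolding trans_mult_def
    by (meson inj_on_imageI2 self_maps_comp)
qed

text \<open>
  Howie's theorem: the singular self-maps of a finite set are products of idempotents of defect
  one. Each step splits such idempotents off a singular map and leaves a singular map with more
  fixed points.
\<close>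

lemma singular_in_generated_collapses:
  assumes "finite I" "f \<in> self_maps I" "\<not> inj_on f I"
  shows "f \<in> generated_maps (collapse ` {(i, j). i \<in> I \<and> j \<in> I \<and> i \<noteq> j})"
  using assms(2,3)
proof (induction "card {x \<in> I. f x \<noteq> x}" arbitrary: f rule: less_induct)
  case less
  let ?E = "collapse ` {(i, j). i \<in> I \<and> j \<in> I \<and> i \<noteq> j}"
  have fI: "\<And>x. x \<in> I \<Longrightarrow> f x \<in> I" and fO: "\<And>x. x \<notin> I \<Longrightarrow> f x = x"
    using less.prems by (auto simp: self_maps_def)
  have gen: "collapse (i, j) \<in> generated_maps ?E" if "i \<in> I" "j \<in> I" "i \<noteq> j" for i j
    using that by (intro subsemigroup_generated.generator) auto
  have "f ` I \<noteq> I"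
    using less.prems assms(1) by (metis eq_card_imp_inj_on)
  then obtain h where h: "h \<in> I" "h \<notin> f ` I"
    using fI by blast
  have fh: "f x \<noteq> h" if "x \<in> I" for x
    using h that by auto
  define f' where "f' = f(h := h)"
  have f_split: "f = collapse (f h, h) \<circ> f'"
    using fh fO h by (fastforce simp: fun_eq_iff f'_def collapse_apply)
  have f'_self: "f' \<in> self_maps I"
    using fI fO h by (auto simp: self_maps_def f'_def)
  show ?case
  proof (cases "inj_on f' I")
    case False
    have "{x \<in> I. f' x \<noteq> x} \<subset> {x \<in> I. f x \<noteq> x}"
      using h fh by (auto simp: f'_def)
    then have "card {x \<in> I. f' x \<noteq> x} < card {x \<in> I. f x \<noteq> x}"
      using assms(1) by (intro psubset_card_mono) auto
    then have "f' \<in> generated_maps ?E"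
      using less.hyps f'_self False by blast
    then show ?thesis
      using generated_comp[of f' ?E "collapse (f h, h)"] gen[of "f h" h] fI h fh f_split by simp
  next
    case True
    have "f' ` I = I"
      using True assms(1) f'_self by (intro endo_inj_surj) (auto simp: self_maps_def)
    show ?thesis
    proof (cases "\<exists>u\<in>I. f' u \<noteq> u")
      case False
      then have "f' = id"
        using f'_self by (auto simp: self_maps_def fun_eq_iff)
      then show ?thesis
        using f_split gen[of "f h" h] fI h fh by simp
    next
      case True
      then obtain u where u: "u \<in> I" "u \<noteq> h" "f u \<noteq> u"
        by (auto simp: f'_def split: if_splits)
      obtain z where z: "z \<in> I" "f' z = f h"
        using \<open>f' ` I = I\<close> fI h by (metis image_iff)
      then have z': "z \<noteq> h" "f z = f h"
        using fh h by (auto simp: f'_def split: if_splits)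
      \<comment> \<open>The map \<open>g\<close> still misses \<open>h\<close>, and it has gained the fixed point \<open>u\<close>.\<close>
      define g where "g = f(h := f u, u := u)"
      have "f = g \<circ> (collapse (h, u) \<circ> collapse (z, h))"
        using u z z' by (auto simp: fun_eq_iff g_def collapse_apply)
      moreover have "g \<in> generated_maps ?E"
      proof (rule less.hyps)
        have "{x \<in> I. g x \<noteq> x} \<subset> {x \<in> I. f x \<noteq> x}"
          using h fh u by (auto simp: g_def)
        then show "card {x \<in> I. g x \<noteq> x} < card {x \<in> I. f x \<noteq> x}"
          using assms(1) by (intro psubset_card_mono) auto
        show "g \<in> self_maps I"
          using fI fO h u by (auto simp: self_maps_def g_def)
        have "h \<notin> g ` I"
          using fh u by (auto simp: g_def)
        then show "\<not> inj_on g I"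
          using endo_inj_surj[OF assms(1)] \<open>g \<in> self_maps I\<close> h by (auto simp: self_maps_def)
      qed
      ultimately show ?thesis
        using generated_comp[OF generated_comp[OF gen[of z h] gen[of h u]], of g] h(1) u(1,2) z(1) z'
        by simp
    qed
  qed
qed

section \<open>Strongly connected semicomplete digraphs\<close>

text \<open>
  Relations \<open>R\<close> on \<open>I\<close> that contain at least one arc between any two distinct points and are
  strongly connected. Tournaments are the case of exactly one arc; allowing two makes the convention
  for two vertices an instance of the general definition.
\<close>

definition strong_semicomplete :: "'i set \<Rightarrow> 'i rel \<Rightarrow> bool" where
  "strong_semicomplete I R \<longleftrightarrow> R \<subseteq> I \<times> I \<and> irrefl R \<and>
     (\<forall>i\<in>I. \<forall>j\<in>I. i \<noteq> j \<longrightarrow> (i, j) \<in> R \<or> (j, i) \<in> R) \<and> (\<forall>i\<in>I. \<forall>j\<in>I. (i, j) \<in> R\<^sup>*)"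

text \<open>
  A product whose kernel only identifies \<open>u\<close> and \<open>v\<close> starts with a factor of this kernel, and
  every further factor leaves the missing point in place or moves it along an arc. Hence the
  missing point performs a walk.
\<close>

lemma missing_point_walk:
  assumes fin: "finite I"
    and idem: "\<And>m x. m \<in> M \<Longrightarrow> m (m x) = m x"
    and M: "M \<subseteq> self_maps I" "\<And>m. m \<in> M \<Longrightarrow> \<not> inj_on m I"
    and R: "R = {(i, j). i \<in> I \<and> j \<in> I \<and> i \<noteq> j \<and> collapse (i, j) \<in> M}"
    and "f \<in> generated_maps M"
    and "u \<in> I" "v \<in> I" "u \<noteq> v" "f u = f v"
    and "\<And>x y. x \<in> I \<Longrightarrow> y \<in> I \<Longrightarrow> f x = f y \<Longrightarrow> x = y \<or> {x, y} = {u, v}"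
  shows "\<exists>i j k. (i, j) \<in> R \<and> {i, j} = {u, v} \<and> (j, k) \<in> R\<^sup>* \<and> k \<in> I \<and> k \<notin> f ` I"
  using assms(6-)
proof (induction arbitrary: u v rule: subsemigroup_generated.induct)
  case (generator f)
  have f: "\<And>x. x \<in> I \<Longrightarrow> f x \<in> I" "\<And>x. x \<notin> I \<Longrightarrow> f x = x"
    using generator.hyps M by (auto simp: self_maps_def)
  have fix_or: "f x = x \<or> {f x, x} = {u, v}" if "x \<in> I" for x
    using generator.prems(5)[of "f x" x] f that idem[OF generator.hyps] by auto
  have uv: "f u = u \<or> f u = v"
    using fix_or[of u] generator.prems by (auto simp: doubleton_eq_iff)
  have other: "f x = x" if "x \<noteq> u" "x \<noteq> v" for x
    using fix_or[of x] f that by (cases "x \<in> I") (auto simp: doubleton_eq_iff)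
  define i where "i = f u"
  define j where "j = (if f u = u then v else u)"
  have ij: "{i, j} = {u, v}" "i \<noteq> j" "i \<in> I" "j \<in> I"
    using uv generator.prems by (auto simp: i_def j_def)
  have "f = collapse (i, j)"
  proof
    fix x show "f x = collapse (i, j) x"
      using uv other[of x] generator.prems(3,4) by (auto simp: collapse_apply i_def j_def)
  qed
  then have "(i, j) \<in> R" "j \<notin> f ` I"
    using ij generator.hyps by (auto simp: R collapse_apply)
  then show ?case
    using ij by blast
next
  case (product f g)
  have comp: "trans_mult f g x = g (f x)" for x
    by (simp add: trans_mult_def)
  have f: "\<And>x. x \<in> I \<Longrightarrow> f x \<in> I" "\<not> inj_on f I" and g: "\<not> inj_on g I"
    using generated_singular[OF product.hyps(1) M] generated_singular[OF product.hyps(2) M]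
    by (auto simp: self_maps_def)
  have ker_f: "x = y \<or> {x, y} = {u, v}" if "x \<in> I" "y \<in> I" "f x = f y" for x y
    using product.prems(5)[OF that(1,2)] that by (simp add: comp)
  obtain x y where "x \<in> I" "y \<in> I" "f x = f y" "x \<noteq> y"
    using f(2) by (auto simp: inj_on_def)
  then have "f u = f v"
    using ker_f[of x y] by (auto simp: doubleton_eq_iff)
  then obtain i j k where 1: "(i, j) \<in> R" "{i, j} = {u, v}" "(j, k) \<in> R\<^sup>*" "k \<in> I" "k \<notin> f ` I"
    using product.IH(1)[OF product.prems(1-3)] ker_f by blast
  have "inj_on f (I - {u})"
    using ker_f by (fastforce simp: inj_on_def doubleton_eq_iff)
  then have "card (f ` (I - {u})) = card (I - {k})"
    using fin product.prems(1) 1(4) by (simp add: card_image)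
  moreover have "f ` (I - {u}) \<subseteq> I - {k}"
    using f 1 by auto
  ultimately have im_f: "f ` (I - {u}) = I - {k}"
    using fin by (intro card_subset_eq) auto
  have g_inj: "inj_on g (I - {k})"
  proof (rule inj_onI)
    fix x y assume "x \<in> I - {k}" "y \<in> I - {k}" "g x = g y"
    moreover have "I - {k} \<subseteq> f ` (I - {u})"
      using im_f by simp
    ultimately obtain x' y' where "x' \<in> I - {u}" "y' \<in> I - {u}" "x = f x'" "y = f y'"
      by blast
    then show "x = y"
      using product.prems(5)[of x' y'] \<open>g x = g y\<close> by (auto simp: comp doubleton_eq_iff)
  qed
  moreover obtain x y where "x \<in> I" "y \<in> I" "g x = g y" "x \<noteq> y"
    using g by (auto simp: inj_on_def)
  ultimately obtain l where l: "l \<in> I" "l \<noteq> k" "g k = g l"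
    by (metis DiffI inj_onD singletonD)
  have ker_g: "x = y \<or> {x, y} = {k, l}" if "x \<in> I" "y \<in> I" "g x = g y" for x y
    using g_inj l that unfolding inj_on_def by (metis DiffI insert_commute singletonD)
  obtain i' j' k' where 2: "(i', j') \<in> R" "{i', j'} = {k, l}" "(j', k') \<in> R\<^sup>*" "k' \<in> I" "k' \<notin> g ` I"
    using product.IH(2)[OF \<open>k \<in> I\<close> l(1) _ l(3) ker_g] l(2) by blast
  have "(k, k') \<in> R\<^sup>*"
    using 2 by (metis converse_rtrancl_into_rtrancl doubleton_eq_iff)
  then have "(j, k') \<in> R\<^sup>*"
    using 1 by simp
  moreover have "k' \<notin> trans_mult f g ` I"
    using 2 f by (auto simp: comp)
  ultimately show ?case
    using 1 2 by blast
qed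

lemma generated_collapses_imp_strong:
  assumes fin: "finite I"
    and idem: "\<And>m x. m \<in> M \<Longrightarrow> m (m x) = m x"
    and M: "M \<subseteq> self_maps I" "\<And>m. m \<in> M \<Longrightarrow> \<not> inj_on m I"
    and gen: "\<And>i j. i \<in> I \<Longrightarrow> j \<in> I \<Longrightarrow> i \<noteq> j \<Longrightarrow> collapse (i, j) \<in> generated_maps M"
  shows "strong_semicomplete I {(i, j). i \<in> I \<and> j \<in> I \<and> i \<noteq> j \<and> collapse (i, j) \<in> M}"
    (is "strong_semicomplete I ?R")
proof -
  have main: "(u, v) \<in> ?R \<or> (v, u) \<in> ?R \<and> (u, v) \<in> ?R\<^sup>*"
    if uv: "u \<in> I" "v \<in> I" "u \<noteq> v" for u v
  proof -
    have "\<exists>i j k. (i, j) \<in> ?R \<and> {i, j} = {u, v} \<and> (j, k) \<in> ?R\<^sup>* \<and> k \<in> I \<and> k \<notin> collapse (u, v) ` I"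
      using uv
      by (intro missing_point_walk[OF fin idem M refl gen[OF uv] uv])
         (auto simp: collapse_apply split: if_splits)
    then obtain i j where "(i, j) \<in> ?R" "{i, j} = {u, v}" "(j, v) \<in> ?R\<^sup>*"
      using collapse_image[OF uv] by blast
    then show ?thesis
      by (auto simp: doubleton_eq_iff)
  qed
  then have "(u, v) \<in> ?R\<^sup>*" if "u \<in> I" "v \<in> I" for u v
    using that by (cases "u = v") (auto dest: r_into_rtrancl)
  then show ?thesis
    using main unfolding strong_semicomplete_def by (auto simp: irrefl_def)
qed

text \<open>
  Conversely, collapsing along an arc \<open>(i, j)\<close> and then moving the missing point \<open>j\<close> along a walk
  to \<open>i\<close> gives a map that permutes \<open>I - {i}\<close> and identifies \<open>i\<close> with \<open>j\<close>; a power of it is the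
  idempotent of the reversed arc \<open>(j, i)\<close>.
\<close>

lemma strong_imp_generated_collapse:
  assumes fin: "finite I" and R: "strong_semicomplete I R"
    and ij: "i \<in> I" "j \<in> I" "i \<noteq> j"
  shows "collapse (j, i) \<in> generated_maps (collapse ` R)"
proof (cases "(j, i) \<in> R")
  case True
  then show ?thesis by (intro subsemigroup_generated.generator) auto
next
  case False
  have RI: "R \<subseteq> I \<times> I" and irr: "irrefl R"
    using R by (auto simp: strong_semicomplete_def)
  have "(i, j) \<in> R" "(j, i) \<in> R\<^sup>*"
    using R ij False by (auto simp: strong_semicomplete_def)
  let ?P = "\<lambda>k g. g \<in> self_maps I \<and> g i = g j \<and> inj_on g (I - {i}) \<and> k \<notin> g ` I"
  have "\<exists>g \<in> generated_maps (collapse ` R). ?P k g" if "(j, k) \<in> R\<^sup>*" for k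
    using that
  proof (induction rule: rtrancl_induct)
    case base
    have "collapse (i, j) \<in> generated_maps (collapse ` R)"
      using \<open>(i, j) \<in> R\<close> by (intro subsemigroup_generated.generator) auto
    moreover have "?P j (collapse (i, j))"
      using ij collapse_self_maps collapse_image by (auto simp: collapse_apply inj_on_def)
    ultimately show ?case by blast
  next
    case (step k l)
    then obtain g where g: "g \<in> generated_maps (collapse ` R)" "?P k g"
      by blast
    have kl: "k \<in> I" "l \<in> I" "k \<noteq> l"
      using step RI irr by (auto simp: irrefl_def)
    have "collapse (k, l) \<in> generated_maps (collapse ` R)"
      using step by (intro subsemigroup_generated.generator) auto
    then have "collapse (k, l) \<circ> g \<in> generated_maps (collapse ` R)"
      using g generated_comp by blast
    moreover have "?P l (collapse (k, l) \<circ> g)"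
    proof (intro conjI)
      show "collapse (k, l) \<circ> g \<in> self_maps I"
        using g collapse_self_maps[OF kl(1,2)] self_maps_comp by blast
      show "(collapse (k, l) \<circ> g) i = (collapse (k, l) \<circ> g) j"
        using g by simp
      show "inj_on (collapse (k, l) \<circ> g) (I - {i})"
        using g by (intro comp_inj_on) (auto simp: inj_on_def collapse_apply)
      show "l \<notin> (collapse (k, l) \<circ> g) ` I"
        using kl by (auto simp: collapse_apply)
    qed
    ultimately show ?case by blast
  qed
  then obtain g where g: "g \<in> generated_maps (collapse ` R)" "?P i g"
    using \<open>(j, i) \<in> R\<^sup>*\<close> by blast
  define J where "J = I - {i}"
  have gJ: "g ` J \<subseteq> J" "inj_on g J"
    using g by (auto simp: J_def self_maps_def)
  have "bij_betw g J J"
    using gJ fin by (simp add: J_def bij_betw_def endo_inj_surj)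
  define p where "p x = (if x \<in> J then g x else x)" for x
  have "p permutes J"
    using \<open>bij_betw g J J\<close> by (intro bij_imp_permutes) (auto simp: p_def cong: bij_betw_cong)
  then have "permutation p"
    using fin by (auto simp: permutation_permutes J_def)
  then obtain n where n: "p ^^ n = id" "n > 0"
    by (rule permutation_is_nilpotent)
  have "(g ^^ m) x = (p ^^ m) x \<and> (p ^^ m) x \<in> J" if "x \<in> J" for m x
    using that gJ by (induction m) (auto simp: p_def)
  then have fixJ: "(g ^^ n) x = x" if "x \<in> J" for x
    using that n by simp
  obtain m where m: "n = Suc m"
    using n by (cases n) auto
  have "(g ^^ n) i = (g ^^ n) j"
    using g unfolding m funpow_Suc_right by simp
  then have gi: "(g ^^ n) i = j"
    using fixJ ij by (simp add: J_def)
  have gO: "(g ^^ n) x = x" if "x \<notin> I" for x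
    using that g by (induction n) (auto simp: self_maps_def)
  have "g ^^ n = collapse (j, i)"
  proof
    fix x show "(g ^^ n) x = collapse (j, i) x"
      using fixJ gi gO by (cases "x \<in> I") (auto simp: collapse_apply J_def ij(1))
  qed
  then show ?thesis
    using generated_funpow[OF g(1) n(2)] by simp
qed

lemma collapses_generated_iff:
  assumes fin: "finite I"
    and idem: "\<And>m x. m \<in> M \<Longrightarrow> m (m x) = m x"
    and M: "M \<subseteq> self_maps I" "\<And>m. m \<in> M \<Longrightarrow> \<not> inj_on m I"
  shows "collapse ` {(i, j). i \<in> I \<and> j \<in> I \<and> i \<noteq> j} \<subseteq> generated_maps M \<longleftrightarrow>
    (\<exists>R. strong_semicomplete I R \<and> collapse ` R \<subseteq> M)"
proof
  assume "collapse ` {(i, j). i \<in> I \<and> j \<in> I \<and> i \<noteq> j} \<subseteq> generated_maps M"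
  then have "strong_semicomplete I {(i, j). i \<in> I \<and> j \<in> I \<and> i \<noteq> j \<and> collapse (i, j) \<in> M}"
    by (intro generated_collapses_imp_strong[OF fin idem M]) auto
  then show "\<exists>R. strong_semicomplete I R \<and> collapse ` R \<subseteq> M"
    by (intro exI[of _ "{(i, j). i \<in> I \<and> j \<in> I \<and> i \<noteq> j \<and> collapse (i, j) \<in> M}"]) auto
next
  assume "\<exists>R. strong_semicomplete I R \<and> collapse ` R \<subseteq> M"
  then obtain R where R: "strong_semicomplete I R" "collapse ` R \<subseteq> M"
    by blast
  then have "collapse (i, j) \<in> generated_maps M" if "i \<in> I" "j \<in> I" "i \<noteq> j" for i j
    using strong_imp_generated_collapse[OF fin R(1)] generated_mono[OF R(2)] that by blast
  then show "collapse ` {(i, j). i \<in> I \<and> j \<in> I \<and> i \<noteq> j} \<subseteq> generated_maps M"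
    by blast
qed

text \<open>Two-element subsets of the vertex set, as images of arcs, control the number of arcs.\<close>

lemma strong_semicomplete_pairs:
  assumes "strong_semicomplete I R"
  shows "(\<lambda>(i, j). {i, j}) ` R = {P. P \<subseteq> I \<and> card P = 2}"
proof (intro equalityI subsetI)
  fix P assume "P \<in> {P. P \<subseteq> I \<and> card P = 2}"
  then obtain i j where ij: "P = {i, j}" "i \<in> I" "j \<in> I" "i \<noteq> j"
    by (auto simp: card_2_iff)
  then have "(i, j) \<in> R \<or> (j, i) \<in> R"
    using assms by (auto simp: strong_semicomplete_def)
  then show "P \<in> (\<lambda>(i, j). {i, j}) ` R"
    unfolding ij(1) by (metis (mono_tags, lifting) case_prod_conv imageI insert_commute)
next
  fix P assume "P \<in> (\<lambda>(i, j). {i, j}) ` R"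
  then obtain i j where "P = {i, j}" "(i, j) \<in> R"
    by auto
  then show "P \<in> {P. P \<subseteq> I \<and> card P = 2}"
    using assms by (auto simp: strong_semicomplete_def irrefl_def card_insert_if)
qed

lemma tournament_simple:
  "tournament Y \<lparr>pverts = Y, parcs = R\<rparr> \<longleftrightarrow> R \<subseteq> Y \<times> Y \<and> irrefl R \<and>
    (\<forall>i\<in>Y. \<forall>j\<in>Y. i \<noteq> j \<longrightarrow> ((i, j) \<in> R) \<noteq> ((j, i) \<in> R))"
proof -
  have "pair_loopfree_digraph \<lparr>pverts = Y, parcs = R\<rparr> \<longleftrightarrow> R \<subseteq> Y \<times> Y \<and> irrefl R"
    unfolding pair_loopfree_digraph_def pair_wf_digraph_def pair_loopfree_digraph_axioms_def irrefl_def
    by (auto simp: mem_Times_iff)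
  then show ?thesis
    by (simp add: tournament_def)
qed

lemma strong_semicomplete_two:
  fixes R :: "nat rel"
  shows "strong_semicomplete {1..2} R \<longleftrightarrow> R = {(1, 2), (2, 1)}"
proof
  assume R: "strong_semicomplete {1..2} R"
  have sub: "R \<subseteq> {(1, 2), (2, 1)}"
  proof
    fix p assume "p \<in> R"
    then have "fst p \<in> {1..2}" "snd p \<in> {1..2}" "fst p \<noteq> snd p"
      using R by (auto simp: strong_semicomplete_def irrefl_def)
    then show "p \<in> {(1, 2), (2, 1)}"
      by (cases p) auto
  qed
  have "(1, 2) \<in> R\<^sup>*" "(2, 1) \<in> R\<^sup>*"
    using R by (auto simp: strong_semicomplete_def)
  then obtain x y where "(1, x) \<in> R" "(2, y) \<in> R"
    by (metis converse_rtranclE numeral_eq_one_iff semiring_norm(83))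
  then have "(1, 2) \<in> R" "(2, 1) \<in> R"
    using sub by auto
  then show "R = {(1, 2), (2, 1)}"
    using sub by auto
next
  assume "R = {(1, 2), (2, 1)}"
  moreover have "{1..2} = {1, 2 :: nat}"
    by auto
  ultimately show "strong_semicomplete {1..2} R"
    unfolding strong_semicomplete_def irrefl_def by (auto intro: r_into_rtrancl)
qed

lemma rho_le_card_arcs:
  fixes R :: "nat rel"
  assumes "strong_semicomplete {1..r} R"
  shows "rho r \<le> card R"
proof (cases "r = 2")
  case True
  then have "R = {(1, 2), (2, 1)}"
    using assms strong_semicomplete_two by blast
  then show ?thesis
    using True by (simp add: rho_def)
next
  case False
  have "finite R"
    using assms finite_subset[of R "{1..r} \<times> {1..r}"] by (simp add: strong_semicomplete_def)
  then have "card ((\<lambda>(i, j). {i, j}) ` R) \<le> card R"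
    by (rule card_image_le)
  also have "card ((\<lambda>(i, j). {i, j}) ` R) = rho r"
    unfolding strong_semicomplete_pairs[OF assms] using False by (simp add: rho_def n_subsets)
  finally show ?thesis .
qed

text \<open>For at least three vertices the smallest such digraphs have one arc for each pair.\<close>

lemma strong_tournament_iff:
  fixes R :: "nat rel"
  assumes "2 < r"
  shows "\<lparr>pverts = {1..r}, parcs = R\<rparr> \<in> strong_tournaments r \<longleftrightarrow>
    strong_semicomplete {1..r} R \<and> card R = rho r"
proof -
  let ?pair = "\<lambda>(i, j). {i, j :: nat}"
  let ?G = "\<lparr>pverts = {1..r}, parcs = R\<rparr>"
  have tour: "tournament {1..r} ?G \<longleftrightarrow> R \<subseteq> {1..r} \<times> {1..r} \<and> irrefl R \<and>
    (\<forall>i\<in>{1..r}. \<forall>j\<in>{1..r}. i \<noteq> j \<longrightarrow> ((i, j) \<in> R) \<noteq> ((j, i) \<in> R))"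
    by (rule tournament_simple)
  have strong: "strongly_connected (with_proj ?G) \<longleftrightarrow> (\<forall>i\<in>{1..r}. \<forall>j\<in>{1..r}. (i, j) \<in> R\<^sup>*)"
    if RI: "R \<subseteq> {1..r} \<times> {1..r}"
  proof -
    have "(i, j) \<in> rtrancl_on {1..r} R" if "(i, j) \<in> R\<^sup>*" "i \<in> {1..r}" for i j
      using that RI by (induction rule: rtrancl_induct) (auto intro: rtrancl_on_into_rtrancl_on)
    then have "(i, j) \<in> rtrancl_on {1..r} R \<longleftrightarrow> (i, j) \<in> R\<^sup>*" if "i \<in> {1..r}" for i j
      using that rtrancl_on_rtranclI by metis
    then show ?thesis
      using assms by (simp add: strongly_connected_def reachable_def)
  qed
  have card: "card R = rho r \<longleftrightarrow> (\<forall>i j. (i, j) \<in> R \<longrightarrow> (j, i) \<notin> R)"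
    if R: "strong_semicomplete {1..r} R"
  proof -
    have fin: "finite R"
      using R finite_subset[of R "{1..r} \<times> {1..r}"] by (simp add: strong_semicomplete_def)
    have "card (?pair ` R) = rho r"
      unfolding strong_semicomplete_pairs[OF R] using assms by (simp add: rho_def n_subsets)
    then have "card R = rho r \<longleftrightarrow> inj_on ?pair R"
      using fin by (metis card_image eq_card_imp_inj_on)
    also have "\<dots> \<longleftrightarrow> (\<forall>i j. (i, j) \<in> R \<longrightarrow> (j, i) \<notin> R)"
    proof
      assume inj: "inj_on ?pair R"
      show "\<forall>i j. (i, j) \<in> R \<longrightarrow> (j, i) \<notin> R"
      proof (intro allI impI notI)
        fix i j assume "(i, j) \<in> R" "(j, i) \<in> R"
        moreover have "?pair (i, j) = ?pair (j, i)"
          by (simp add: insert_commute)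
        ultimately have "(i, j) = (j, i)"
          using inj_onD[OF inj] by blast
        moreover have "irrefl R"
          using R unfolding strong_semicomplete_def by blast
        ultimately show False
          using \<open>(i, j) \<in> R\<close> unfolding irrefl_def by blast
      qed
    next
      assume asym: "\<forall>i j. (i, j) \<in> R \<longrightarrow> (j, i) \<notin> R"
      show "inj_on ?pair R"
      proof (rule inj_onI)
        fix p q assume pq: "p \<in> R" "q \<in> R" "?pair p = ?pair q"
        obtain i j k l where ijkl: "p = (i, j)" "q = (k, l)"
          by (metis surj_pair)
        then have "p = q \<or> p = (l, k)"
          using pq(3) by (auto simp: doubleton_eq_iff)
        then show "p = q"
          using asym pq(1,2) ijkl(2) by blast
      qed
    qed
    finally show ?thesis .
  qed
  have "?G \<in> strong_tournaments r \<longleftrightarrow> tournament {1..r} ?G \<and> strongly_connected (with_proj ?G)"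
    using assms by (simp add: strong_tournaments_def)
  also have "\<dots> \<longleftrightarrow> strong_semicomplete {1..r} R \<and> (\<forall>i j. (i, j) \<in> R \<longrightarrow> (j, i) \<notin> R)"
  proof
    assume L: "tournament {1..r} ?G \<and> strongly_connected (with_proj ?G)"
    then have R: "R \<subseteq> {1..r} \<times> {1..r}" "irrefl R"
      and one: "\<And>i j. i \<in> {1..r} \<Longrightarrow> j \<in> {1..r} \<Longrightarrow> i \<noteq> j \<Longrightarrow> ((i, j) \<in> R) \<noteq> ((j, i) \<in> R)"
      unfolding tour by blast+
    have "strong_semicomplete {1..r} R"
      using R one L strong[OF R(1)] unfolding strong_semicomplete_def by (intro conjI) (assumption | blast)+
    moreover have "(j, i) \<notin> R" if "(i, j) \<in> R" for i j
    proof -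
      have "i \<in> {1..r}" "j \<in> {1..r}" "i \<noteq> j"
        using R that by (auto simp: irrefl_def)
      then show ?thesis
        using one that by blast
    qed
    ultimately show "strong_semicomplete {1..r} R \<and> (\<forall>i j. (i, j) \<in> R \<longrightarrow> (j, i) \<notin> R)"
      by blast
  next
    assume L: "strong_semicomplete {1..r} R \<and> (\<forall>i j. (i, j) \<in> R \<longrightarrow> (j, i) \<notin> R)"
    then have R: "R \<subseteq> {1..r} \<times> {1..r}" "irrefl R"
      and conn: "\<forall>i\<in>{1..r}. \<forall>j\<in>{1..r}. (i, j) \<in> R\<^sup>*"
      and one: "\<And>i j. i \<in> {1..r} \<Longrightarrow> j \<in> {1..r} \<Longrightarrow> i \<noteq> j \<Longrightarrow> ((i, j) \<in> R) \<noteq> ((j, i) \<in> R)"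
      unfolding strong_semicomplete_def by blast+
    have "tournament {1..r} ?G"
      unfolding tour using R one by blast
    then show "tournament {1..r} ?G \<and> strongly_connected (with_proj ?G)"
      using conn strong[OF R(1)] by blast
  qed
  also have "\<dots> \<longleftrightarrow> strong_semicomplete {1..r} R \<and> card R = rho r"
    using card by blast
  finally show ?thesis .
qed

lemma bij_betw_strong_tournaments:
  assumes "1 < r"
  shows "bij_betw parcs (strong_tournaments r)
    {R. strong_semicomplete {1..r} R \<and> card R = rho r}"
proof (rule bij_betw_byWitness[where f' = "\<lambda>R. \<lparr>pverts = {1..r}, parcs = R\<rparr>"])
  have verts: "pverts \<Gamma> = {1..r}" if "\<Gamma> \<in> strong_tournaments r" for \<Gamma>
    using that by (auto simp: strong_tournaments_def tournament_def split: if_splits)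
  show eta: "\<forall>\<Gamma>\<in>strong_tournaments r. \<lparr>pverts = {1..r}, parcs = parcs \<Gamma>\<rparr> = \<Gamma>"
    using verts by (metis pair_pre_digraph.surjective old.unit.exhaust)
  have iff: "\<lparr>pverts = {1..r}, parcs = R\<rparr> \<in> strong_tournaments r \<longleftrightarrow>
    strong_semicomplete {1..r} R \<and> card R = rho r" for R
  proof (cases "r = 2")
    case True
    have "{1, 2} = {1..2::nat}" by auto
    then show ?thesis
      using True strong_semicomplete_two[of R] by (auto simp: strong_tournaments_def rho_def)
  qed (use assms strong_tournament_iff in auto)
  then show "parcs ` strong_tournaments r \<subseteq> {R. strong_semicomplete {1..r} R \<and> card R = rho r}"
    using eta by fastforce
  show "(\<lambda>R. \<lparr>pverts = {1..r}, parcs = R\<rparr>) ` {R. strong_semicomplete {1..r} R \<and> card R = rho r}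
    \<subseteq> strong_tournaments r"
    using iff by auto
qed simp

lemma strong_tournaments_nonempty:
  assumes "1 < r"
  shows "strong_tournaments r \<noteq> {}"
proof (cases "r = 2")
  case True
  then show ?thesis by (simp add: strong_tournaments_def)
next
  case False
  \<comment> \<open>the path from 1 to \<open>r\<close>, with every other arc pointing backwards\<close>
  define R where "R = {(i, j). i \<in> {1..r} \<and> j \<in> {1..r} \<and> (j = Suc i \<or> Suc j < i)}"
  have up: "(i, j) \<in> R\<^sup>*" if "i \<le> j" "1 \<le> i" "j \<le> r" for i j
    using that
  proof (induction j rule: dec_induct)
    case (step m)
    then have "(m, Suc m) \<in> R" by (auto simp: R_def)
    then show ?case using step by (auto intro: rtrancl_into_rtrancl)
  qed simp
  have "(r, 1) \<in> R"
    using assms False by (auto simp: R_def)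
  then have conn: "(i, j) \<in> R\<^sup>*" if "i \<in> {1..r}" "j \<in> {1..r}" for i j
    using up[of i r] up[of 1 j] that by (auto intro: rtrancl_trans rtrancl_into_rtrancl)
  have "strongly_connected (with_proj \<lparr>pverts = {1..r}, parcs = R\<rparr>)"
  proof -
    have "(i, j) \<in> rtrancl_on {1..r} R" if "(i, j) \<in> R\<^sup>*" "i \<in> {1..r}" for i j
      using that by (induction rule: rtrancl_induct) (auto simp: R_def intro: rtrancl_on_into_rtrancl_on)
    then show ?thesis
      using assms conn unfolding strongly_connected_def reachable_def by auto
  qed
  moreover have "tournament {1..r} \<lparr>pverts = {1..r}, parcs = R\<rparr>"
    unfolding tournament_simple by (auto simp: R_def irrefl_def)
  ultimately show ?thesis
    using False unfolding strong_tournaments_def by auto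
qed

section \<open>Counting surjections\<close>

text \<open>The surjections from \<open>K\<close> onto \<open>T\<close>, with the value \<open>undefined\<close> outside \<open>K\<close> so that they can be counted.\<close>

definition surjections :: "'k set \<Rightarrow> 't set \<Rightarrow> ('k \<Rightarrow> 't) set" where
  "surjections K T = {s \<in> PiE K (\<lambda>_. T). s ` K = T}"

text \<open>
  The restriction to \<open>K\<close> of a surjection from \<open>insert x K\<close> hits all of \<open>T\<close>, or misses only the image
  \<open>y\<close> of \<open>x\<close>. This gives the recurrence of the Stirling numbers.
\<close>

lemma surjections_insert:
  assumes "x \<notin> K"
  shows "surjections (insert x K) T =
    (\<lambda>(y, g). g(x := y)) ` (SIGMA y:T. surjections K T \<union> surjections K (T - {y}))"
proof (intro equalityI subsetI)
  fix s assume s: "s \<in> surjections (insert x K) T"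
  then obtain y g where yg: "y \<in> T" "g \<in> PiE K (\<lambda>_. T)" "s = g(x := y)"
    unfolding surjections_def PiE_insert_eq by auto
  have "insert y (g ` K) = T"
    using s yg assms by (auto simp: surjections_def cong: image_cong_simp)
  then have "g \<in> surjections K T \<union> surjections K (T - {y})"
    using yg by (cases "y \<in> g ` K") (auto simp: surjections_def PiE_iff)
  then show "s \<in> (\<lambda>(y, g). g(x := y)) ` (SIGMA y:T. surjections K T \<union> surjections K (T - {y}))"
    using yg by force
next
  fix s assume "s \<in> (\<lambda>(y, g). g(x := y)) ` (SIGMA y:T. surjections K T \<union> surjections K (T - {y}))"
  then obtain y g where yg: "y \<in> T" "g \<in> surjections K T \<union> surjections K (T - {y})" "s = g(x := y)"
    by auto
  then have "g \<in> PiE K (\<lambda>_. T)" "insert y (g ` K) = T"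
    by (auto simp: surjections_def PiE_iff)
  moreover have "g(x := y) ` K = g ` K"
    using assms by (intro image_cong) auto
  then have "g(x := y) ` insert x K = insert y (g ` K)"
    by (simp only: image_insert fun_upd_same)
  moreover have "g(x := y) \<in> PiE (insert x K) (\<lambda>_. T)"
    using yg(1) \<open>g \<in> PiE K (\<lambda>_. T)\<close> by (rule PiE_fun_upd)
  ultimately show "s \<in> surjections (insert x K) T"
    unfolding surjections_def yg(3) by (simp only: mem_Collect_eq)
qed

lemma card_surjections:
  fixes K :: "'k set" and T :: "'t set"
  assumes "finite K" "finite T"
  shows "card (surjections K T) = fact (card T) * Stirling (card K) (card T)"
  using assms
proof (induction K arbitrary: T rule: finite_induct)
  case empty
  have "surjections ({} :: 'k set) T = (if T = {} then {\<lambda>_. undefined} else {})"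
    by (auto simp: surjections_def)
  then show ?case
    using empty by (cases "T = {}") (simp_all add: card_gt_0_iff)
next
  case (insert x K)
  have fin: "finite (surjections K U)" if "U \<subseteq> T" for U
    using insert.hyps(1) finite_subset[OF that insert.prems]
    unfolding surjections_def by (simp add: finite_PiE)
  have "surjections K U \<subseteq> PiE K (\<lambda>_. T)" if "U \<subseteq> T" for U
    using that PiE_mono[of K "\<lambda>_. U" "\<lambda>_. T"] by (auto simp: surjections_def)
  then have "(SIGMA y:T. surjections K T \<union> surjections K (T - {y})) \<subseteq> T \<times> PiE K (\<lambda>_. T)"
    by blast
  then have "inj_on (\<lambda>(y, g). g(x := y)) (SIGMA y:T. surjections K T \<union> surjections K (T - {y}))"
    using inj_combinator[OF insert.hyps(2), of "\<lambda>_. T"] inj_on_subset by blast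
  then have "card (surjections (insert x K) T) =
    card (SIGMA y:T. surjections K T \<union> surjections K (T - {y}))"
    unfolding surjections_insert[OF insert.hyps(2)] by (rule card_image)
  also have "\<dots> = (\<Sum>y\<in>T. card (surjections K T \<union> surjections K (T - {y})))"
    using insert.prems fin by (intro card_SigmaI) auto
  also have "\<dots> = (\<Sum>y\<in>T. card (surjections K T) + card (surjections K (T - {y})))"
  proof (rule sum.cong[OF refl])
    fix y assume "y \<in> T"
    then show "card (surjections K T \<union> surjections K (T - {y})) =
      card (surjections K T) + card (surjections K (T - {y}))"
      using fin by (intro card_Un_disjoint) (auto simp: surjections_def)
  qed
  also have "\<dots> = fact (card T) * Stirling (card (insert x K)) (card T)"
    using insert by (cases "card T") (auto simp: card_Diff_singleton algebra_simps)
  finally show ?case .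
qed

text \<open>
  Subsets of \<open>K \<times> T\<close> that project onto both factors and have no more elements than \<open>K\<close> are
  graphs of surjections.
\<close>

lemma card_minimal_projecting_sets:
  assumes "finite K" "finite T"
  shows "card {H. H \<subseteq> K \<times> T \<and> fst ` H = K \<and> snd ` H = T \<and> card H = card K} =
    card (surjections K T)"
proof -
  let ?graph = "\<lambda>s. (\<lambda>x. (x, s x)) ` K"
  let ?H = "{H. H \<subseteq> K \<times> T \<and> fst ` H = K \<and> snd ` H = T \<and> card H = card K}"
  have "?graph ` surjections K T = ?H"
  proof (intro equalityI subsetI)
    fix H assume "H \<in> ?graph ` surjections K T"
    then show "H \<in> ?H"
      by (auto simp: surjections_def image_image card_image inj_on_def)
  next
    fix H assume H: "H \<in> ?H"
    then have inj: "inj_on fst H"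
      using assms by (intro eq_card_imp_inj_on) (auto intro: finite_subset)
    define s where "s = restrict (\<lambda>x. snd (inv_into H fst x)) K"
    have s: "s (fst h) = snd h" "fst h \<in> K" if "h \<in> H" for h
      using that H inj by (auto simp: s_def inv_into_f_f)
    have "?graph s = (\<lambda>h. (fst h, s (fst h))) ` H"
      using H by auto
    also have "\<dots> = H"
      using s(1) by (auto simp: image_iff)
    finally have graph: "?graph s = H" .
    have "s ` K = s ` fst ` H"
      using H by simp
    also have "\<dots> = snd ` H"
      using s(1) by (auto simp: image_image)
    finally have "s ` K = T"
      using H by simp
    then have "s \<in> surjections K T"
      by (auto simp: surjections_def s_def)
    then show "H \<in> ?graph ` surjections K T"
      using graph by blast
  qed
  moreover have "inj_on ?graph (surjections K T)"
  proof (rule inj_onI)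
    fix s t assume st: "s \<in> surjections K T" "t \<in> surjections K T" "?graph s = ?graph t"
    then have "s x = t x" if "x \<in> K" for x
      using that by blast
    then show "s = t"
      using st by (intro PiE_ext[of s K "\<lambda>_. T"]) (auto simp: surjections_def)
  qed
  ultimately show ?thesis
    using card_image by metis
qed

lemma bij_betw_restrict:
  assumes "bij_betw f A B" "\<And>x. x \<in> A \<Longrightarrow> x \<in> P \<longleftrightarrow> f x \<in> Q" "P \<subseteq> A" "Q \<subseteq> B"
  shows "bij_betw f P Q"
proof -
  have "f ` P = Q"
    using assms bij_betw_imp_surj_on[OF assms(1)] by blast
  then show ?thesis
    using assms by (meson bij_betw_subset)
qed

section \<open>The variant as a sandwich semigroup\<close>

text \<open>
  An idempotent transformation factors as \<open>rep \<circ> idx\<close>, where \<open>idx\<close> names the kernel class of a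
  point by an index in \<open>I\<close> and \<open>rep\<close> selects the image point in the class.
\<close>

locale sandwich =
  fixes I :: "'i set" and idx :: "'a::finite \<Rightarrow> 'i" and rep :: "'i \<Rightarrow> 'a"
  assumes idx_in: "idx x \<in> I" and idx_rep: "i \<in> I \<Longrightarrow> idx (rep i) = i"
begin

text \<open>The multiplication of the variant by the idempotent \<open>rep \<circ> idx\<close>.\<close>

abbreviation star :: "('a \<Rightarrow> 'a) \<Rightarrow> ('a \<Rightarrow> 'a) \<Rightarrow> 'a \<Rightarrow> 'a" where
  "star \<equiv> variant_mult (rep \<circ> idx)"

lemma star_apply: "star f g x = g (rep (idx (f x)))"
  by (simp add: variant_mult_def trans_mult_def)

lemma finite_I: "finite I"
proof -
  have "I \<subseteq> range idx"
    using idx_rep by (metis rangeI subsetI)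
  then show ?thesis
    by (rule finite_subset) simp
qed

lemma inj_rep: "inj_on rep I"
  using idx_rep by (metis inj_onI)

text \<open>
  The homomorphism from the variant to the self-maps of \<open>I\<close> that only records how the
  distinguished points are moved between the kernel classes.
\<close>

definition shadow :: "('a \<Rightarrow> 'a) \<Rightarrow> 'i \<Rightarrow> 'i" where
  "shadow f i = (if i \<in> I then idx (f (rep i)) else i)"

lemma shadow_self_maps: "shadow f \<in> self_maps I"
  by (auto simp: self_maps_def shadow_def idx_in)

lemma shadow_star: "shadow (star f g) = shadow g \<circ> shadow f"
  by (auto simp: fun_eq_iff shadow_def star_apply idx_in)

lemma idempotent_iff: "f \<in> idempotents star \<longleftrightarrow> (\<forall>x. f (rep (idx (f x))) = f x)"
  by (simp add: idempotents_def fun_eq_iff star_apply)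

lemma shadow_idem: "f \<in> idempotents star \<Longrightarrow> shadow f (shadow f i) = shadow f i"
  by (simp add: idempotent_iff shadow_def idx_in)

lemma shadow_singular:
  assumes "f \<in> idempotents star" "shadow f \<noteq> id"
  shows "\<not> inj_on (shadow f) I"
proof
  assume "inj_on (shadow f) I"
  moreover have "shadow f i \<in> I" if "i \<in> I" for i
    using that by (simp add: shadow_def idx_in)
  ultimately have "shadow f i = i" if "i \<in> I" for i
    using that shadow_idem[OF assms(1)] by (meson inj_onD)
  then have "shadow f = id"
    by (auto simp: fun_eq_iff shadow_def)
  then show False
    using assms(2) by simp
qed

text \<open>
  The idempotents of the variant over a self-map of \<open>I\<close>. The fiber over the identity will be called
  the band.
\<close>

definition fiber :: "('i \<Rightarrow> 'i) \<Rightarrow> ('a \<Rightarrow> 'a) set" where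
  "fiber \<theta> = {f \<in> idempotents star. shadow f = \<theta>}"

text \<open>
  An idempotent over \<open>\<theta>\<close> is given by the class of each value, which prescribes the kernel, and by
  the value chosen in each class that is met, which prescribes the image. These two data are the
  coordinates of the idempotent; they can be chosen independently of each other.
\<close>

definition kernel_maps :: "('i \<Rightarrow> 'i) \<Rightarrow> ('a \<Rightarrow> 'i) set" where
  "kernel_maps \<theta> = {\<kappa>. (\<forall>x. \<kappa> x \<in> \<theta> ` I) \<and> (\<forall>i\<in>I. \<kappa> (rep i) = \<theta> i)}"

definition transversals :: "('i \<Rightarrow> 'i) \<Rightarrow> ('i \<Rightarrow> 'a) set" where
  "transversals \<theta> = PiE (\<theta> ` I) (\<lambda>k. {x. idx x = k})"

definition coords :: "('i \<Rightarrow> 'i) \<Rightarrow> ('a \<Rightarrow> 'a) \<Rightarrow> ('a \<Rightarrow> 'i) \<times> ('i \<Rightarrow> 'a)" where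
  "coords \<theta> f = (idx \<circ> f, restrict (f \<circ> rep) (\<theta> ` I))"

lemma bij_betw_coords:
  assumes \<theta>: "\<theta> \<in> self_maps I" "\<And>i. \<theta> (\<theta> i) = \<theta> i"
  shows "bij_betw (coords \<theta>) (fiber \<theta>) (kernel_maps \<theta> \<times> transversals \<theta>)"
proof (rule bij_betw_byWitness[where f' = "\<lambda>(\<kappa>, \<tau>). \<tau> \<circ> \<kappa>"])
  have \<theta>I: "\<theta> i \<in> I" if "i \<in> I" for i
    using \<theta>(1) that by (auto simp: self_maps_def)
  have \<theta>fix: "\<theta> k = k" "k \<in> I" if "k \<in> \<theta> ` I" for k
    using that \<theta>(2) \<theta>I by auto
  have f1: "idx (f x) \<in> \<theta> ` I" "idx (f (rep i)) = \<theta> i" "f (rep (idx (f x))) = f x"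
    if "f \<in> fiber \<theta>" "i \<in> I" for f x i
  proof -
    have sh: "idx (f (rep j)) = \<theta> j" if "j \<in> I" for j
      using \<open>f \<in> fiber \<theta>\<close> that unfolding fiber_def shadow_def by auto
    show id: "f (rep (idx (f x))) = f x"
      using that by (auto simp: fiber_def idempotent_iff)
    show "idx (f x) \<in> \<theta> ` I"
      using sh[OF idx_in[of "f x"]] id idx_in by (metis image_eqI)
    show "idx (f (rep i)) = \<theta> i"
      using sh that by simp
  qed
  show "\<forall>f\<in>fiber \<theta>. (case coords \<theta> f of (\<kappa>, \<tau>) \<Rightarrow> \<tau> \<circ> \<kappa>) = f"
  proof
    fix f assume "f \<in> fiber \<theta>"
    then show "(case coords \<theta> f of (\<kappa>, \<tau>) \<Rightarrow> \<tau> \<circ> \<kappa>) = f"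
      using f1(1,3)[OF _ idx_in] by (simp add: coords_def fun_eq_iff)
  qed
  show "coords \<theta> ` fiber \<theta> \<subseteq> kernel_maps \<theta> \<times> transversals \<theta>"
  proof (rule image_subsetI)
    fix f assume f: "f \<in> fiber \<theta>"
    have "idx \<circ> f \<in> kernel_maps \<theta>"
      unfolding kernel_maps_def using f1(1)[OF f idx_in] f1(2)[OF f] by simp
    moreover have "restrict (f \<circ> rep) (\<theta> ` I) \<in> transversals \<theta>"
      unfolding transversals_def
    proof (rule restrict_PiE[THEN iffD2], rule Pi_I)
      fix k assume "k \<in> \<theta> ` I"
      then show "(f \<circ> rep) k \<in> {x. idx x = k}"
        using f1(2)[OF f, of k] \<theta>fix[of k] by simp
    qed
    ultimately show "coords \<theta> f \<in> kernel_maps \<theta> \<times> transversals \<theta>"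
      by (simp add: coords_def)
  qed
  have kt: "\<kappa> x \<in> \<theta> ` I" "i \<in> I \<Longrightarrow> \<kappa> (rep i) = \<theta> i" "k \<in> \<theta> ` I \<Longrightarrow> idx (\<tau> k) = k"
    if "\<kappa> \<in> kernel_maps \<theta>" "\<tau> \<in> transversals \<theta>" for \<kappa> \<tau> x i k
    using that unfolding kernel_maps_def transversals_def by (simp, simp, fastforce)
  show "\<forall>p\<in>kernel_maps \<theta> \<times> transversals \<theta>. coords \<theta> (case p of (\<kappa>, \<tau>) \<Rightarrow> \<tau> \<circ> \<kappa>) = p"
  proof clarify
    fix \<kappa> \<tau> assume p: "\<kappa> \<in> kernel_maps \<theta>" "\<tau> \<in> transversals \<theta>"
    have "idx \<circ> (\<tau> \<circ> \<kappa>) = \<kappa>"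
      using kt[OF p] by (simp add: fun_eq_iff)
    moreover have "restrict ((\<tau> \<circ> \<kappa>) \<circ> rep) (\<theta> ` I) = \<tau>"
    proof (rule extensionalityI[of _ "\<theta> ` I"])
      show "\<tau> \<in> extensional (\<theta> ` I)"
        using p by (auto simp: transversals_def PiE_iff)
      fix k assume "k \<in> \<theta> ` I"
      then show "restrict ((\<tau> \<circ> \<kappa>) \<circ> rep) (\<theta> ` I) k = \<tau> k"
        using kt(2)[OF p, of k] \<theta>fix[of k] by simp
    qed simp
    ultimately show "coords \<theta> (\<tau> \<circ> \<kappa>) = (\<kappa>, \<tau>)"
      by (simp add: coords_def)
  qed
  show "(\<lambda>(\<kappa>, \<tau>). \<tau> \<circ> \<kappa>) ` (kernel_maps \<theta> \<times> transversals \<theta>) \<subseteq> fiber \<theta>"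
  proof clarify
    fix \<kappa> \<tau> assume p: "\<kappa> \<in> kernel_maps \<theta>" "\<tau> \<in> transversals \<theta>"
    have "\<theta> x = x" if "x \<notin> I" for x
      using \<theta>(1) that by (auto simp: self_maps_def)
    then have "shadow (\<tau> \<circ> \<kappa>) = \<theta>"
      using kt(2,3)[OF p] by (auto simp: fun_eq_iff shadow_def)
    moreover have "\<tau> (\<kappa> (rep (idx (\<tau> (\<kappa> x))))) = \<tau> (\<kappa> x)" for x
      using kt(1)[OF p, of x] kt(2,3)[OF p, of "\<kappa> x"] \<theta>fix[of "\<kappa> x"] by simp
    then have "\<tau> \<circ> \<kappa> \<in> idempotents star"
      by (simp add: idempotent_iff)
    ultimately show "\<tau> \<circ> \<kappa> \<in> fiber \<theta>"
      by (simp add: fiber_def)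
  qed
qed

lemma card_kernel_maps:
  assumes \<theta>: "\<theta> \<in> self_maps I"
  shows "card (kernel_maps \<theta>) = card (\<theta> ` I) ^ (card (UNIV :: 'a set) - card I)"
proof -
  have \<theta>I: "\<theta> ` I \<noteq> {}"
    using idx_in by auto
  have "bij_betw (\<lambda>\<kappa>. restrict \<kappa> (- rep ` I)) (kernel_maps \<theta>) (PiE (- rep ` I) (\<lambda>_. \<theta> ` I))"
  proof (rule bij_betw_byWitness[where f' = "\<lambda>g x. if x \<in> rep ` I then \<theta> (idx x) else g x"])
    show "\<forall>\<kappa>\<in>kernel_maps \<theta>. (\<lambda>x. if x \<in> rep ` I then \<theta> (idx x) else restrict \<kappa> (- rep ` I) x) = \<kappa>"
      by (auto simp: kernel_maps_def fun_eq_iff idx_rep)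
    show "\<forall>g\<in>PiE (- rep ` I) (\<lambda>_. \<theta> ` I).
      restrict (\<lambda>x. if x \<in> rep ` I then \<theta> (idx x) else g x) (- rep ` I) = g"
      by (auto simp: fun_eq_iff PiE_iff extensional_def restrict_def)
    show "(\<lambda>\<kappa>. restrict \<kappa> (- rep ` I)) ` kernel_maps \<theta> \<subseteq> PiE (- rep ` I) (\<lambda>_. \<theta> ` I)"
      by (auto simp: kernel_maps_def)
    show "(\<lambda>g x. if x \<in> rep ` I then \<theta> (idx x) else g x) ` PiE (- rep ` I) (\<lambda>_. \<theta> ` I) \<subseteq> kernel_maps \<theta>"
      by (auto simp: kernel_maps_def idx_in idx_rep PiE_iff)
  qed
  then have "card (kernel_maps \<theta>) = card (PiE (- rep ` I) (\<lambda>_. \<theta> ` I))"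
    by (rule bij_betw_same_card)
  also have "\<dots> = card (\<theta> ` I) ^ card (- rep ` I)"
    by (simp add: card_PiE)
  also have "card (- rep ` I) = card (UNIV :: 'a set) - card I"
    using inj_rep finite_I by (simp add: card_Diff_subset Compl_eq_Diff_UNIV card_image)
  finally show ?thesis .
qed

lemma card_transversals: "card (transversals \<theta>) = (\<Prod>k\<in>\<theta> ` I. card {x. idx x = k})"
  unfolding transversals_def using finite_I by (simp add: card_PiE)

lemma card_fiber:
  assumes "\<theta> \<in> self_maps I" "\<And>i. \<theta> (\<theta> i) = \<theta> i"
  shows "card (fiber \<theta>) =
    card (\<theta> ` I) ^ (card (UNIV :: 'a set) - card I) * (\<Prod>k\<in>\<theta> ` I. card {x. idx x = k})"
proof -
  have "card (fiber \<theta>) = card (kernel_maps \<theta>) * card (transversals \<theta>)"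
    using bij_betw_same_card[OF bij_betw_coords[OF assms]] by (simp only: card_cartesian_product)
  then show ?thesis
    by (simp only: card_kernel_maps[OF assms(1)] card_transversals)
qed

lemma fiber_nonempty:
  assumes "\<theta> \<in> self_maps I" "\<And>i. \<theta> (\<theta> i) = \<theta> i"
  shows "fiber \<theta> \<noteq> {}"
proof -
  have "\<theta> i \<in> I" if "i \<in> I" for i
    using assms(1) that by (auto simp: self_maps_def)
  moreover have "\<theta> i = i" if "i \<notin> I" for i
    using assms(1) that by (auto simp: self_maps_def)
  ultimately have "rep \<circ> \<theta> \<circ> idx \<in> fiber \<theta>"
    using assms(2) by (auto simp: fiber_def idempotent_iff idx_rep idx_in shadow_def fun_eq_iff)
  then show ?thesis by blast
qed

lemma finite_kernel_maps_transversals: "finite (kernel_maps id)" "finite (transversals id)"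
proof -
  have "bij_betw (coords id) (fiber id) (kernel_maps id \<times> transversals id)"
    by (rule bij_betw_coords) (auto simp: self_maps_def)
  then have "kernel_maps id \<times> transversals id = coords id ` fiber id"
    by (simp add: bij_betw_imp_surj_on)
  moreover have "fiber id \<noteq> {}"
    by (rule fiber_nonempty) (auto simp: self_maps_def)
  ultimately have "finite (kernel_maps id \<times> transversals id)" "kernel_maps id \<times> transversals id \<noteq> {}"
    by simp_all
  then show "finite (kernel_maps id)" "finite (transversals id)"
    by (auto simp: finite_cartesian_product_iff)
qed

text \<open>
  This follows from \<open>l \<le> r ^ (l - 1)\<close> for the sizes \<open>l\<close> of the kernel classes, which add up to the
  size of the base set. It makes the number of kernels the minimal size of a generating set of the band.
\<close>

lemma card_transversals_le:
  assumes "2 \<le> card I"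
  shows "card (transversals id) \<le> card (kernel_maps id)"
proof -
  let ?l = "\<lambda>k. card {x. idx x = k}"
  have pos: "?l k \<ge> 1" if "k \<in> I" for k
    using idx_rep[OF that] by (auto simp: Suc_le_eq card_gt_0_iff)
  have total: "(\<Sum>k\<in>I. ?l k) = card (UNIV :: 'a set)"
    using sum.group[of UNIV I idx "\<lambda>_. 1 :: nat"] finite_I idx_in by (simp add: image_subset_iff)
  have "card (transversals id) = (\<Prod>k\<in>I. ?l k)"
    by (simp add: card_transversals)
  also have "\<dots> \<le> (\<Prod>k\<in>I. card I ^ (?l k - 1))"
  proof (rule prod_mono, safe)
    fix k assume "k \<in> I"
    have "?l k - 1 < 2 ^ (?l k - 1)"
      by (rule less_exp)
    also have "\<dots> \<le> card I ^ (?l k - 1)"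
      using assms by (rule power_mono) simp
    finally show "?l k \<le> card I ^ (?l k - 1)"
      by simp
  qed
  also have "\<dots> = card I ^ (\<Sum>k\<in>I. ?l k - 1)"
    by (simp add: power_sum)
  also have "(\<Sum>k\<in>I. ?l k - 1) = card (UNIV :: 'a set) - card I"
    using sum_subtractf_nat[of I "\<lambda>_. 1" ?l] pos total by simp
  also have "card I ^ (card (UNIV :: 'a set) - card I) = card (kernel_maps id)"
    by (subst card_kernel_maps) (auto simp: self_maps_def)
  finally show ?thesis .
qed

end

context sandwich
begin

section \<open>Generating sets of idempotents\<close>

lemma id_self_maps: "id \<in> self_maps I"
  by (simp add: self_maps_def)

lemma bij_betw_coords_id: "bij_betw (coords id) (fiber id) (kernel_maps id \<times> transversals id)"
  using bij_betw_coords[OF id_self_maps] by simp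

text \<open>
  The band is rectangular: a product in it inherits the kernel of its first
  and the image of its last factor. The second alternative collects the products with at least one
  factor outside the band.
\<close>

lemma generated_coords:
  assumes "f \<in> subsemigroup_generated star G"
  shows "shadow f = id \<and> fst (coords id f) \<in> fst ` coords id ` (G \<inter> {g. shadow g = id}) \<and>
      snd (coords id f) \<in> snd ` coords id ` (G \<inter> {g. shadow g = id}) \<or>
    shadow f \<in> generated_maps (shadow ` (G - {g. shadow g = id}))"
  using assms
proof (induction rule: subsemigroup_generated.induct)
  case (generator f)
  show ?case
  proof (cases "shadow f = id")
    case True
    then have "f \<in> G \<inter> {g. shadow g = id}"
      using generator by blast
    then show ?thesis
      using True by blast
  next
    case False
    then have "shadow f \<in> shadow ` (G - {g. shadow g = id})"
      using generator by blast
    then show ?thesis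
      using subsemigroup_generated.generator by metis
  qed
next
  case (product f g)
  let ?S = "generated_maps (shadow ` (G - {g. shadow g = id}))"
  let ?A = "fst ` coords id ` (G \<inter> {g. shadow g = id})"
  let ?B = "snd ` coords id ` (G \<inter> {g. shadow g = id})"
  consider "shadow f = id" "shadow g = id" "fst (coords id f) \<in> ?A" "snd (coords id g) \<in> ?B"
    | "shadow f \<in> ?S" "shadow g = id" | "shadow f = id" "shadow g \<in> ?S"
    | "shadow f \<in> ?S" "shadow g \<in> ?S"
    using product.IH by blast
  then show ?case
  proof cases
    case 1
    have sh: "idx (f (rep i)) = i" "idx (g (rep i)) = i" if "i \<in> I" for i
      using fun_cong[OF 1(1), of i] fun_cong[OF 1(2), of i] that by (simp_all add: shadow_def)
    have "fst (coords id (star f g)) = fst (coords id f)"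
      using sh idx_in by (simp add: coords_def fun_eq_iff star_apply)
    moreover have "snd (coords id (star f g)) = snd (coords id g)"
      using sh by (auto simp: coords_def star_apply restrict_def)
    moreover have "shadow (star f g) = id"
      using 1 by (simp add: shadow_star)
    ultimately show ?thesis
      using 1(3,4) by metis
  next
    case 4
    then show ?thesis
      using generated_comp unfolding shadow_star by blast
  qed (simp_all only: shadow_star comp_id id_comp simp_thms)
qed

lemma generated_lift_shadow:
  assumes "\<phi> \<in> generated_maps (shadow ` M)"
  shows "\<exists>f \<in> subsemigroup_generated star M. shadow f = \<phi>"
  using assms
proof (induction rule: subsemigroup_generated.induct)
  case (generator x)
  then show ?case by (auto intro: subsemigroup_generated.generator)
next
  case (product x y)
  then obtain f g where "f \<in> subsemigroup_generated star M" "g \<in> subsemigroup_generated star M"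
    "shadow f = x" "shadow g = y"
    by blast
  then have "star f g \<in> subsemigroup_generated star M" "shadow (star f g) = trans_mult x y"
    by (auto simp only: shadow_star trans_mult_def subsemigroup_generated.product)
  then show ?case
    by blast
qed

text \<open>
  Left and right multiplication by the band carries any \<open>g\<close> to every idempotent with the same shadow.
\<close>

lemma idempotent_factorization:
  assumes f: "f \<in> idempotents star" and g: "shadow g = shadow f"
  shows "\<exists>u\<in>fiber id. \<exists>v\<in>fiber id. f = star u (star g v)"
proof -
  have ff: "f (rep (idx (f x))) = f x" for x
    using f by (simp add: idempotent_iff)
  \<comment> \<open>\<open>\<kappa>\<close> sends \<open>x\<close> to the index of a distinguished point with the same value under \<open>f\<close>, and \<open>\<tau>\<close> is a
    transversal of the classes that contains the image of \<open>f\<close>.\<close>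
  define \<kappa> where "\<kappa> x = (if x \<in> rep ` I then idx x else idx (f x))" for x
  define \<tau> where "\<tau> k = (if k \<in> shadow f ` I then f (rep k) else rep k)" for k
  have \<kappa>: "\<kappa> x \<in> I" "f (rep (\<kappa> x)) = f x" for x
    using ff idx_in by (auto simp: \<kappa>_def idx_rep)
  have \<kappa>_rep: "\<kappa> (rep i) = i" if "i \<in> I" for i
    using that by (simp add: \<kappa>_def idx_rep)
  have \<tau>: "idx (\<tau> k) = k" if "k \<in> I" for k
  proof (cases "k \<in> shadow f ` I")
    case True
    then have "shadow f k = k"
      using shadow_idem[OF f] by auto
    then show ?thesis
      using True that by (simp add: \<tau>_def shadow_def)
  qed (use that in \<open>simp add: \<tau>_def idx_rep\<close>)
  have "rep \<circ> \<kappa> \<in> fiber id"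
    using \<kappa>(1) \<kappa>_rep by (auto simp: fiber_def idempotent_iff shadow_def idx_rep fun_eq_iff)
  moreover have "\<tau> \<circ> idx \<in> fiber id"
    using \<tau> idx_in by (auto simp: fiber_def idempotent_iff shadow_def idx_rep fun_eq_iff)
  moreover have "f x = star (rep \<circ> \<kappa>) (star g (\<tau> \<circ> idx)) x" for x
  proof -
    have "idx (g (rep (\<kappa> x))) = idx (f (rep (\<kappa> x)))"
      using fun_cong[OF g, of "\<kappa> x"] \<kappa>(1) by (simp add: shadow_def)
    then have "star (rep \<circ> \<kappa>) (star g (\<tau> \<circ> idx)) x = \<tau> (idx (f x))"
      using \<kappa> idx_in by (simp add: star_apply idx_rep)
    moreover have "idx (f x) = shadow f (idx (f x))"
      using ff idx_in by (simp add: shadow_def)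
    ultimately show ?thesis
      using ff[of x] idx_in[of "f x"] by (auto simp: \<tau>_def)
  qed
  ultimately show ?thesis
    by blast
qed

lemma shadows_outside_band:
  assumes "G \<subseteq> idempotents star"
  shows "shadow ` (G - fiber id) \<subseteq> self_maps I"
    and "m \<in> shadow ` (G - fiber id) \<Longrightarrow> \<not> inj_on m I"
    and "m \<in> shadow ` (G - fiber id) \<Longrightarrow> m (m i) = m i"
proof -
  show "shadow ` (G - fiber id) \<subseteq> self_maps I"
    using shadow_self_maps by blast
  assume "m \<in> shadow ` (G - fiber id)"
  then obtain f where "m = shadow f" "f \<in> idempotents star" "f \<notin> fiber id"
    using assms by blast
  moreover from this have "shadow f \<noteq> id"
    unfolding fiber_def by blast
  ultimately show "\<not> inj_on m I" "m (m i) = m i"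
    using shadow_singular shadow_idem by metis+
qed

text \<open>
  A set of idempotents generates all idempotents exactly if its elements in the band exhaust all
  kernels and all images and its remaining shadows contain a strongly connected semicomplete digraph.
\<close>

lemma generates_iff:
  assumes G: "G \<subseteq> idempotents star"
  shows "idempotents star \<subseteq> subsemigroup_generated star G \<longleftrightarrow>
    fst ` coords id ` (G \<inter> fiber id) = kernel_maps id \<and>
    snd ` coords id ` (G \<inter> fiber id) = transversals id \<and>
    (\<exists>R. strong_semicomplete I R \<and> collapse ` R \<subseteq> shadow ` (G - fiber id))"
    (is "?gen \<longleftrightarrow> ?top \<and> ?top' \<and> ?bot")
proof -
  let ?E = "collapse ` {(i, j). i \<in> I \<and> j \<in> I \<and> i \<noteq> j}"
  note out = shadows_outside_band[OF G]
  have bot: "?bot \<longleftrightarrow> ?E \<subseteq> generated_maps (shadow ` (G - fiber id))"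
    by (rule collapses_generated_iff[symmetric, OF finite_I out(3,1,2)])
  have band: "G \<inter> {g. shadow g = id} = G \<inter> fiber id" "G - {g. shadow g = id} = G - fiber id"
    using G by (auto simp: fiber_def)
  have sing: "\<not> inj_on \<phi> I" if "\<phi> \<in> generated_maps (shadow ` (G - fiber id))" for \<phi>
    using generated_singular[OF that out(1,2)] by blast
  have coords_fiber: "fst ` coords id ` fiber id = kernel_maps id"
    "snd ` coords id ` fiber id = transversals id"
  proof -
    have im: "coords id ` fiber id = kernel_maps id \<times> transversals id"
      using bij_betw_coords_id by (rule bij_betw_imp_surj_on)
    have "fiber id \<noteq> {}"
      by (rule fiber_nonempty[OF id_self_maps]) simp
    then have ne: "kernel_maps id \<noteq> {}" "transversals id \<noteq> {}"
      using im by auto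
    show "fst ` coords id ` fiber id = kernel_maps id" "snd ` coords id ` fiber id = transversals id"
      unfolding im using ne by simp_all
  qed
  show ?thesis
  proof
    assume gen: ?gen
    have top: "fst (coords id f) \<in> fst ` coords id ` (G \<inter> fiber id)"
      "snd (coords id f) \<in> snd ` coords id ` (G \<inter> fiber id)" if "f \<in> fiber id" for f
    proof -
      have "f \<in> subsemigroup_generated star G" "shadow f = id"
        using that gen by (auto simp: fiber_def)
      moreover have "id \<notin> generated_maps (shadow ` (G - fiber id))"
        using sing[of id] by auto
      ultimately show "fst (coords id f) \<in> fst ` coords id ` (G \<inter> fiber id)"
        "snd (coords id f) \<in> snd ` coords id ` (G \<inter> fiber id)"
        using generated_coords[of f G] unfolding band by auto
    qed
    have "fst ` coords id ` (G \<inter> fiber id) = fst ` coords id ` fiber id"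
      "snd ` coords id ` (G \<inter> fiber id) = snd ` coords id ` fiber id"
      using top by (fastforce, fastforce)
    moreover have "?E \<subseteq> generated_maps (shadow ` (G - fiber id))"
    proof
      fix e assume "e \<in> ?E"
      then obtain i j where e: "e = collapse (i, j)" "i \<in> I" "j \<in> I" "i \<noteq> j"
        by auto
      obtain f where f: "f \<in> fiber e"
        using fiber_nonempty[of e] e collapse_self_maps collapse_idem by fastforce
      then have "f \<in> subsemigroup_generated star G" "shadow f = e"
        using gen by (auto simp: fiber_def)
      moreover have "e \<noteq> id"
        using collapse_not_inj e by fastforce
      ultimately show "e \<in> generated_maps (shadow ` (G - fiber id))"
        using generated_coords[of f G] unfolding band by auto
    qed
    ultimately show "?top \<and> ?top' \<and> ?bot"
      unfolding bot coords_fiber by blast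
  next
    assume R: "?top \<and> ?top' \<and> ?bot"
    have band_gen: "f \<in> subsemigroup_generated star G" if f: "f \<in> fiber id" for f
    proof -
      have "coords id f \<in> kernel_maps id \<times> transversals id"
        using f bij_betw_coords_id by (auto dest: bij_betwE)
      then have "fst (coords id f) \<in> fst ` coords id ` (G \<inter> fiber id)"
        "snd (coords id f) \<in> snd ` coords id ` (G \<inter> fiber id)"
        using R by (auto simp: mem_Times_iff)
      then obtain g h where gh: "g \<in> G" "h \<in> G" "fst (coords id f) = fst (coords id g)"
        "snd (coords id f) = snd (coords id h)"
        by (elim imageE) auto
      have "f x = star g h x" for x
      proof -
        have "idx (g x) = idx (f x)"
          using fun_cong[OF gh(3), of x] by (simp add: coords_def)
        moreover have "h (rep (idx (f x))) = f (rep (idx (f x)))"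
          using fun_cong[OF gh(4), of "idx (f x)"] idx_in by (simp add: coords_def)
        ultimately show ?thesis
          using f by (simp add: star_apply fiber_def idempotent_iff)
      qed
      then have "f = star g h"
        by blast
      then show ?thesis
        using gh by (metis subsemigroup_generated.intros)
    qed
    show ?gen
    proof
      fix f assume f: "f \<in> idempotents star"
      show "f \<in> subsemigroup_generated star G"
      proof (cases "shadow f = id")
        case True
        then show ?thesis
          using f band_gen by (simp add: fiber_def)
      next
        case False
        then have "shadow f \<in> generated_maps ?E"
          using singular_in_generated_collapses[OF finite_I shadow_self_maps] shadow_singular f by blast
        moreover have "?E \<subseteq> generated_maps (shadow ` (G - fiber id))"
          using R bot by blast
        ultimately have "shadow f \<in> generated_maps (shadow ` (G - fiber id))"
          by (rule generated_subset[rotated])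
        then obtain g where g: "g \<in> subsemigroup_generated star (G - fiber id)" "shadow g = shadow f"
          using generated_lift_shadow by blast
        then have "g \<in> subsemigroup_generated star G"
          using generated_mono[of "G - fiber id" G star] by blast
        then show ?thesis
          using idempotent_factorization[OF f g(2)] band_gen subsemigroup_generated.product by metis
      qed
    qed
  qed
qed

section \<open>Counting the generating sets of minimal size\<close>

text \<open>
  The two independent halves of a generating set of minimal size: a generating set of the band, and
  a set of \<open>q\<close> other idempotents whose shadows contain the arcs of a strongly connected semicomplete
  digraph. Below, \<open>q\<close> is a lower bound for the number of arcs of such
  digraphs.
\<close>

definition band_parts :: "('a \<Rightarrow> 'a) set set" where
  "band_parts = {H. H \<subseteq> fiber id \<and> fst ` coords id ` H = kernel_maps id \<and>
     snd ` coords id ` H = transversals id \<and> card H = card (kernel_maps id)}"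

definition singular_parts :: "nat \<Rightarrow> ('a \<Rightarrow> 'a) set set" where
  "singular_parts q = {L. L \<subseteq> idempotents star - fiber id \<and> card L = q \<and>
     (\<exists>R. strong_semicomplete I R \<and> collapse ` R \<subseteq> shadow ` L)}"

lemma card_band_parts:
  "card band_parts = fact (card (transversals id)) *
    Stirling (card (kernel_maps id)) (card (transversals id))"
proof -
  let ?K = "kernel_maps id" and ?T = "transversals id"
  let ?M = "{H. H \<subseteq> ?K \<times> ?T \<and> fst ` H = ?K \<and> snd ` H = ?T \<and> card H = card ?K}"
  have card: "card (coords id ` H) = card H" if "H \<subseteq> fiber id" for H
    using that bij_betw_coords_id by (meson bij_betw_def card_image inj_on_subset)
  have "bij_betw ((`) (coords id)) (Pow (fiber id)) (Pow (?K \<times> ?T))"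
    using bij_betw_coords_id by (rule bij_betw_Pow)
  moreover have "H \<in> band_parts \<longleftrightarrow> coords id ` H \<in> ?M" if "H \<in> Pow (fiber id)" for H
  proof -
    have "coords id ` H \<subseteq> ?K \<times> ?T"
      using that bij_betw_imp_surj_on[OF bij_betw_coords_id] by blast
    then show ?thesis
      using that card[of H] by (simp add: band_parts_def)
  qed
  ultimately have "bij_betw ((`) (coords id)) band_parts ?M"
    by (rule bij_betw_restrict) (auto simp: band_parts_def)
  then have "card band_parts = card ?M"
    by (rule bij_betw_same_card)
  also have "\<dots> = card (surjections ?K ?T)"
    by (rule card_minimal_projecting_sets[OF finite_kernel_maps_transversals])
  also have "\<dots> = fact (card ?T) * Stirling (card ?K) (card ?T)"
    by (rule card_surjections[OF finite_kernel_maps_transversals])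
  finally show ?thesis .
qed

lemma arcs_strong_semicomplete:
  assumes "strong_semicomplete I R"
  shows "finite R" "inj_on collapse R"
    and "p \<in> R \<Longrightarrow> fst p \<in> I \<and> snd p \<in> I \<and> fst p \<noteq> snd p"
proof -
  have R: "R \<subseteq> I \<times> I" "irrefl R"
    using assms by (auto simp: strong_semicomplete_def)
  show "finite R"
    using R finite_I by (meson finite_SigmaI finite_subset)
  show arc: "fst p \<in> I \<and> snd p \<in> I \<and> fst p \<noteq> snd p" if "p \<in> R" for p
    using R that by (cases p) (auto simp: irrefl_def)
  show "inj_on collapse R"
    by (rule inj_onI) (metis arc collapse_inject prod.collapse)
qed

text \<open>
  Because of the bound on the number of arcs, a singular part has exactly one element over each arc of
  its digraph and no others, and the shadows of its elements determine the digraph.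
\<close>

lemma card_singular_parts:
  assumes min: "\<And>R. strong_semicomplete I R \<Longrightarrow> q \<le> card R"
  shows "card (singular_parts q) =
    (\<Sum>R | strong_semicomplete I R \<and> card R = q. \<Prod>p\<in>R. card (fiber (collapse p)))"
proof -
  let ?D = "{R. strong_semicomplete I R \<and> card R = q}"
  let ?S = "\<lambda>R. PiE R (\<lambda>p. fiber (collapse p))"
  have shadow_s: "shadow (s p) = collapse p" if "s \<in> ?S R" "p \<in> R" for s R p
    using that by (auto simp: fiber_def dest!: PiE_mem)
  have shadow_im: "shadow ` s ` R = collapse ` R" if "s \<in> ?S R" for s R
    using shadow_s[OF that] by (auto simp: image_image)
  have arc: "collapse p \<noteq> id" if "R \<in> ?D" "p \<in> R" for R p
    using arcs_strong_semicomplete(3)[of R p] that collapse_not_inj[of "fst p" I "snd p"] by force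
  have union: "singular_parts q = (\<Union>R\<in>?D. (\<lambda>s. s ` R) ` ?S R)"
  proof (intro equalityI subsetI)
    fix L assume "L \<in> singular_parts q"
    then obtain R where L: "L \<subseteq> idempotents star - fiber id" "card L = q"
      and R: "strong_semicomplete I R" "collapse ` R \<subseteq> shadow ` L"
      by (auto simp: singular_parts_def)
    note R' = arcs_strong_semicomplete[OF R(1)]
    have fin: "finite L"
      using min[OF R(1)] L R'(1) R(2) by (cases "q = 0") (auto simp: card_eq_0_iff intro: card_ge_0_finite)
    have "card R = card (collapse ` R)"
      using R'(2) by (simp add: card_image)
    also have "\<dots> \<le> card (shadow ` L)"
      using R(2) fin by (intro card_mono) auto
    finally have le: "card R \<le> card (shadow ` L)" .
    have "card (shadow ` L) \<le> card L"
      using fin by (rule card_image_le)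
    then have cards: "card R = q" "card (shadow ` L) = card L"
      using le min[OF R(1)] L(2) by auto
    have inj: "inj_on shadow L"
      using fin cards(2) by (rule eq_card_imp_inj_on)
    have im: "collapse ` R = shadow ` L"
      using R(2) fin cards L(2) R'(2) by (intro card_subset_eq) (auto simp: card_image)
    define s where "s = restrict (\<lambda>p. inv_into L shadow (collapse p)) R"
    have s: "s p \<in> L" "shadow (s p) = collapse p" if "p \<in> R" for p
    proof -
      have "collapse p \<in> shadow ` L"
        using that im by blast
      then show "s p \<in> L" "shadow (s p) = collapse p"
        using that by (simp_all add: s_def inv_into_into f_inv_into_f)
    qed
    have "s \<in> ?S R"
    proof (rule PiE_I)
      fix p assume "p \<in> R"
      then show "s p \<in> fiber (collapse p)"
        using s[of p] L(1) unfolding fiber_def by blast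
    qed (simp add: s_def)
    moreover have "s ` R = L"
    proof (intro equalityI subsetI)
      fix f assume "f \<in> L"
      then obtain p where "p \<in> R" "shadow f = collapse p"
        using im by (metis imageE imageI)
      then have "f = s p"
        using s inj \<open>f \<in> L\<close> by (metis inj_onD)
      then show "f \<in> s ` R"
        using \<open>p \<in> R\<close> by blast
    qed (use s in auto)
    ultimately show "L \<in> (\<Union>R\<in>?D. (\<lambda>s. s ` R) ` ?S R)"
      using R(1) cards(1) by blast
  next
    fix L assume "L \<in> (\<Union>R\<in>?D. (\<lambda>s. s ` R) ` ?S R)"
    then obtain R s where R: "R \<in> ?D" and s: "s \<in> ?S R" and L: "L = s ` R"
      by blast
    note R' = arcs_strong_semicomplete[of R]
    have "s p \<in> idempotents star - fiber id" if "p \<in> R" for p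
      using that s arc[OF R that] by (auto simp: fiber_def dest!: PiE_mem)
    moreover have "inj_on s R"
      using R R'(2) shadow_s[OF s] by (intro inj_onI) (metis (mono_tags, lifting) inj_onD mem_Collect_eq)
    ultimately show "L \<in> singular_parts q"
      using R shadow_im[OF s] by (auto simp: singular_parts_def L card_image)
  qed
  have "card (singular_parts q) = (\<Sum>R\<in>?D. card ((\<lambda>s. s ` R) ` ?S R))"
    unfolding union
  proof (rule card_UN_disjoint)
    have "?D \<subseteq> Pow (I \<times> I)"
      by (auto simp: strong_semicomplete_def)
    then show "finite ?D"
      by (rule finite_subset) (simp add: finite_I)
    show "\<forall>R\<in>?D. finite ((\<lambda>s. s ` R) ` ?S R)"
      by simp
    show "\<forall>R\<in>?D. \<forall>R'\<in>?D. R \<noteq> R' \<longrightarrow> (\<lambda>s. s ` R) ` ?S R \<inter> (\<lambda>s. s ` R') ` ?S R' = {}"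
    proof (intro ballI impI, rule ccontr)
      fix R R' assume D: "R \<in> ?D" "R' \<in> ?D" "R \<noteq> R'"
        and "(\<lambda>s. s ` R) ` ?S R \<inter> (\<lambda>s. s ` R') ` ?S R' \<noteq> {}"
      then obtain s s' where s: "s \<in> ?S R" "s' \<in> ?S R'" "s ` R = s' ` R'"
        by blast
      then have "collapse ` R = collapse ` R'"
        using shadow_im by metis
      moreover have "inj_on collapse (R \<union> R')"
      proof (rule inj_onI)
        fix p p' assume "p \<in> R \<union> R'" "p' \<in> R \<union> R'" "collapse p = collapse p'"
        moreover from this have "fst p \<noteq> snd p"
          using D arcs_strong_semicomplete(3) by blast
        ultimately show "p = p'"
          by (metis collapse_inject prod.collapse)
      qed
      ultimately show False
        using D(3) by (metis inj_on_image_eq_iff sup_ge1 sup_ge2)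
    qed
  qed
  also have "\<dots> = (\<Sum>R\<in>?D. \<Prod>p\<in>R. card (fiber (collapse p)))"
  proof (rule sum.cong[OF refl])
    fix R assume R: "R \<in> ?D"
    have "inj_on (\<lambda>s. s ` R) (?S R)"
    proof (rule inj_onI)
      fix s s' assume s: "s \<in> ?S R" "s' \<in> ?S R" "s ` R = s' ` R"
      have "s p = s' p" if "p \<in> R" for p
      proof -
        have "s p \<in> s' ` R"
          unfolding s(3)[symmetric] using that by (rule imageI)
        then obtain p' where p': "p' \<in> R" "s p = s' p'"
          by (rule imageE) metis
        then have "collapse p = collapse p'"
          using shadow_s[OF s(1) that] shadow_s[OF s(2) p'(1)] by simp
        then show ?thesis
          using arcs_strong_semicomplete(2)[of R] R that p' by (metis (mono_tags, lifting) inj_onD mem_Collect_eq)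
      qed
      then show "s = s'"
        using s by (intro PiE_ext) auto
    qed
    then show "card ((\<lambda>s. s ` R) ` ?S R) = (\<Prod>p\<in>R. card (fiber (collapse p)))"
      using arcs_strong_semicomplete(1)[of R] R by (simp add: card_image card_PiE)
  qed
  finally show ?thesis .
qed

lemma generating_set_bounds:
  assumes min: "\<And>R. strong_semicomplete I R \<Longrightarrow> q \<le> card R"
    and G: "G \<subseteq> idempotents star" "idempotents star \<subseteq> subsemigroup_generated star G"
  shows "card (kernel_maps id) \<le> card (G \<inter> fiber id)" "q \<le> card (G - fiber id)"
proof -
  have gen: "fst ` coords id ` (G \<inter> fiber id) = kernel_maps id"
    "\<exists>R. strong_semicomplete I R \<and> collapse ` R \<subseteq> shadow ` (G - fiber id)"
    using G generates_iff[OF G(1)] by blast+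
  show "card (kernel_maps id) \<le> card (G \<inter> fiber id)"
    unfolding gen(1)[symmetric] image_image by (rule card_image_le) simp
  obtain R where R: "strong_semicomplete I R" "collapse ` R \<subseteq> shadow ` (G - fiber id)"
    using gen(2) by blast
  have "q \<le> card R"
    using min R(1) by blast
  also have "card R = card (collapse ` R)"
    using arcs_strong_semicomplete(2)[OF R(1)] by (simp add: card_image)
  also have "\<dots> \<le> card (shadow ` (G - fiber id))"
    using R(2) by (intro card_mono) auto
  also have "\<dots> \<le> card (G - fiber id)"
    by (rule card_image_le) simp
  finally show "q \<le> card (G - fiber id)" .
qed

lemma bij_betw_minimal_generating_sets:
  assumes min: "\<And>R. strong_semicomplete I R \<Longrightarrow> q \<le> card R"
  shows "bij_betw (\<lambda>G. (G \<inter> fiber id, G - fiber id))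
    {G. G \<subseteq> idempotents star \<and> idempotents star \<subseteq> subsemigroup_generated star G \<and>
        card G = card (kernel_maps id) + q}
    (band_parts \<times> singular_parts q)"
    (is "bij_betw ?f ?G _")
proof (rule bij_betw_byWitness[where f' = "\<lambda>(H, L). H \<union> L"])
  show "\<forall>G\<in>?G. (case ?f G of (H, L) \<Rightarrow> H \<union> L) = G"
    by auto
  show "\<forall>p\<in>band_parts \<times> singular_parts q. ?f (case p of (H, L) \<Rightarrow> H \<union> L) = p"
    by (auto simp: band_parts_def singular_parts_def)
  show "?f ` ?G \<subseteq> band_parts \<times> singular_parts q"
  proof (rule image_subsetI)
    fix G assume "G \<in> ?G"
    then have G: "G \<subseteq> idempotents star" "idempotents star \<subseteq> subsemigroup_generated star G"
      "card G = card (kernel_maps id) + q"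
      by auto
    have "card G = card (G \<inter> fiber id) + card (G - fiber id)"
      by (rule card_Int_Diff) simp
    then have "card (G \<inter> fiber id) = card (kernel_maps id)" "card (G - fiber id) = q"
      using generating_set_bounds[OF min G(1,2)] G(3) by auto
    then show "?f G \<in> band_parts \<times> singular_parts q"
      using G(1,2) generates_iff[OF G(1)] by (auto simp: band_parts_def singular_parts_def)
  qed
  show "(\<lambda>(H, L). H \<union> L) ` (band_parts \<times> singular_parts q) \<subseteq> ?G"
  proof clarify
    fix H L assume H: "H \<in> band_parts" and L: "L \<in> singular_parts q"
    have parts: "(H \<union> L) \<inter> fiber id = H" "(H \<union> L) - fiber id = L" "H \<inter> L = {}"
      using H L by (auto simp: band_parts_def singular_parts_def)
    have idem: "H \<union> L \<subseteq> idempotents star"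
      using H L by (auto simp: band_parts_def singular_parts_def fiber_def)
    have "idempotents star \<subseteq> subsemigroup_generated star (H \<union> L)"
      using H L unfolding generates_iff[OF idem] parts by (simp add: band_parts_def singular_parts_def)
    moreover have "card (H \<union> L) = card (kernel_maps id) + q"
      using H L parts(3) by (subst card_Un_disjoint) (auto simp: band_parts_def singular_parts_def)
    ultimately show "H \<union> L \<subseteq> idempotents star \<and>
      idempotents star \<subseteq> subsemigroup_generated star (H \<union> L) \<and>
      card (H \<union> L) = card (kernel_maps id) + q"
      using idem by blast
  qed
qed

end

lemma idem_generating_set_iff:
  "idem_generating_set a G \<longleftrightarrow> G \<subseteq> idempotents (variant_mult a) \<and>
    idempotents (variant_mult a) \<subseteq> subsemigroup_generated (variant_mult a) G"
  (is "_ \<longleftrightarrow> G \<subseteq> ?E \<and> ?E \<subseteq> _")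
proof (cases "G \<subseteq> ?E")
  case True
  have "subsemigroup_generated (variant_mult a) G = idem_subsemigroup a \<longleftrightarrow>
    ?E \<subseteq> subsemigroup_generated (variant_mult a) G"
  proof
    assume "subsemigroup_generated (variant_mult a) G = idem_subsemigroup a"
    then show "?E \<subseteq> subsemigroup_generated (variant_mult a) G"
      by (auto simp: idem_subsemigroup_def intro: subsemigroup_generated.generator)
  next
    assume "?E \<subseteq> subsemigroup_generated (variant_mult a) G"
    then show "subsemigroup_generated (variant_mult a) G = idem_subsemigroup a"
      using generated_subset[of ?E "variant_mult a" G] generated_mono[OF True, of "variant_mult a"]
      by (auto simp: idem_subsemigroup_def)
  qed
  then show ?thesis
    by (simp add: idem_generating_set_def)
qed (simp add: idem_generating_set_def)

section \<open>The counting formula\<close>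

lemma sandwich_of_idempotent:
  fixes a :: "'a::finite \<Rightarrow> 'a" and A :: "'i \<Rightarrow> 'a set"
  assumes a: "trans_mult a a = a" and A: "bij_betw A I (UNIV // trans_ker a)"
  obtains idx rep where "sandwich I idx rep" "a = rep \<circ> idx"
    "\<And>i. i \<in> I \<Longrightarrow> A i = {x. idx x = i}"
proof -
  define cls where "cls x = {y. a x = a y}" for x
  have quot: "UNIV // trans_ker a = range cls"
    by (auto simp: quotient_def trans_ker_def cls_def)
  define idx where "idx x = inv_into I A (cls x)" for x
  have idx: "idx x \<in> I" "A (idx x) = cls x" for x
  proof -
    have "cls x \<in> A ` I"
      using bij_betw_imp_surj_on[OF A] quot by blast
    then show "idx x \<in> I" "A (idx x) = cls x"
      by (simp_all add: idx_def inv_into_into f_inv_into_f)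
  qed
  have aa: "a (a x) = a x" for x
    using fun_cong[OF a, of x] by (simp add: trans_mult_def)
  have idx_surj: "\<exists>x. i = idx x" if "i \<in> I" for i
  proof -
    have "A i \<in> range cls"
      using bij_betwE[OF A] that quot by blast
    then obtain x where "A i = cls x"
      by blast
    moreover have "inv_into I A (A i) = i"
      using A that by (simp add: bij_betw_def)
    ultimately have "i = idx x"
      by (simp add: idx_def)
    then show ?thesis ..
  qed
  have idx_eq: "idx x = idx y \<longleftrightarrow> a x = a y" for x y
  proof
    assume "idx x = idx y"
    then have "cls x = cls y"
      using idx(2) by metis
    then show "a x = a y"
      by (auto simp: cls_def)
  next
    assume "a x = a y"
    then show "idx x = idx y"
      by (simp add: idx_def cls_def)
  qed
  define rep where "rep i = a (SOME x. x \<in> A i)" for i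
  have rep: "rep (idx x) = a x" for x
  proof -
    have "(SOME y. y \<in> cls x) \<in> cls x"
      by (rule someI[of _ x]) (simp add: cls_def)
    then show ?thesis
      by (simp add: rep_def idx(2) cls_def)
  qed
  show ?thesis
  proof
    show "sandwich I idx rep"
    proof
      fix i assume "i \<in> I"
      then obtain x where "i = idx x"
        using idx_surj by blast
      then show "idx (rep i) = i"
        using aa by (simp add: rep idx_eq)
    qed (rule idx(1))
    show "a = rep \<circ> idx"
      by (simp add: fun_eq_iff rep)
    fix i assume "i \<in> I"
    then obtain x where "i = idx x"
      using idx_surj by blast
    then show "A i = {x. idx x = i}"
      by (auto simp: idx(2) idx_eq cls_def)
  qed
qed

lemma Stirling_pos: "1 \<le> k \<Longrightarrow> k \<le> n \<Longrightarrow> 0 < Stirling n k"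
proof (induction n arbitrary: k)
  case (Suc n)
  then obtain l where l: "k = Suc l"
    by (cases k) auto
  show ?case
  proof (cases "l = 0")
    case True
    then show ?thesis
      unfolding l by (simp only: Stirling_1)
  next
    case False
    then have "0 < Stirling n l"
      using Suc l by simp
    then show ?thesis
      by (simp add: l)
  qed
qed simp

theorem theorem6p9:
  fixes a :: "'a::finite \<Rightarrow> 'a"
    and A :: "nat \<Rightarrow> 'a set"
    and lam :: "nat \<Rightarrow> nat"
    and n r Lam :: nat
  assumes "n = card (UNIV :: 'a set)"
    and "trans_mult a a = a"
    and "r = trans_rank a"
    and "1 < r" and "r < n"
    and "bij_betw A {1..r} (UNIV // trans_ker a)"
    and "\<And>i. i \<in> {1..r} \<Longrightarrow> lam i = card (A i)"
    and "Lam = (\<Prod>i=1..r. lam i)"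
  shows "(\<exists>G. idem_generating_set a G \<and> card G = r ^ (n - r) + rho r) \<and>
    (\<forall>G. idem_generating_set a G \<longrightarrow> r ^ (n - r) + rho r \<le> card G) \<and>
    real (card {G. idem_generating_set a G \<and> card G = r ^ (n - r) + rho r}) =
      ((real r - 1) ^ (n - r) * real Lam) ^ rho r * fact Lam
      * real (Stirling (r ^ (n - r)) Lam)
      * (\<Sum>\<Gamma>\<in>strong_tournaments r.
           1 / (\<Prod>j=1..r. real (lam j) ^ in_degree (with_proj \<Gamma>) j))"
proof -
  obtain idx rep where sw: "sandwich {1..r} idx rep" and a: "a = rep \<circ> idx"
    and A: "\<And>i. i \<in> {1..r} \<Longrightarrow> A i = {x. idx x = i}"
    using sandwich_of_idempotent[OF assms(2,6)] by metis
  interpret sandwich "{1..r}" idx rep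
    by (rule sw)
  \<comment> \<open>Otherwise the simplifier rewrites the index set \<open>{1..r}\<close> of the interpretation to \<open>{Suc 0..r}\<close>.\<close>
  note One_nat_def [simp del]
  let ?N = "r ^ (n - r)"
  have lam: "card {x. idx x = i} = lam i" if "i \<in> {1..r}" for i
    using assms(7)[OF that] A[OF that] by simp
  have lam_pos: "0 < lam i" if "i \<in> {1..r}" for i
    using lam[OF that] idx_rep[OF that] by (metis card_gt_0_iff empty_iff finite mem_Collect_eq)
  then have Lam_pos: "0 < Lam"
    by (auto simp: assms(8) intro!: prod_pos)
  have card_T: "card (transversals id) = Lam"
    using lam by (simp add: card_transversals assms(8))
  have card_K: "card (kernel_maps id) = ?N"
    using card_kernel_maps[OF id_self_maps] by (simp add: assms(1))
  have min: "\<And>R. strong_semicomplete {1..r} R \<Longrightarrow> rho r \<le> card R"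
    by (rule rho_le_card_arcs)
  have gen_iff: "idem_generating_set a G \<longleftrightarrow>
    G \<subseteq> idempotents star \<and> idempotents star \<subseteq> subsemigroup_generated star G" for G
    unfolding a by (rule idem_generating_set_iff)
  have lower: "?N + rho r \<le> card G" if "idem_generating_set a G" for G
  proof -
    have "card G = card (G \<inter> fiber id) + card (G - fiber id)"
      by (rule card_Int_Diff) simp
    then show ?thesis
      using generating_set_bounds[OF min, of G] that by (simp add: gen_iff card_K)
  qed

  have fiber: "real (card (fiber (collapse p))) = (real r - 1) ^ (n - r) * real Lam / real (lam (snd p))"
    if R: "strong_semicomplete {1..r} R" and "p \<in> R" for R p
  proof -
    obtain i j where p: "p = (i, j)" "i \<in> {1..r}" "j \<in> {1..r}" "i \<noteq> j"
      using arcs_strong_semicomplete(3)[OF R \<open>p \<in> R\<close>] by (metis prod.collapse)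
    have im: "collapse p ` {1..r} = {1..r} - {j}"
      using p collapse_image by metis
    have "card (fiber (collapse p)) = card ({1..r} - {j}) ^ (card (UNIV :: 'a set) - card {1..r}) *
      (\<Prod>k\<in>{1..r} - {j}. card {x. idx x = k})"
      using card_fiber[of "collapse p"] p collapse_self_maps collapse_idem im by metis
    moreover have "(\<Prod>k\<in>{1..r} - {j}. card {x. idx x = k}) = (\<Prod>k\<in>{1..r} - {j}. lam k)"
      using lam by (intro prod.cong) auto
    moreover have "card ({1..r} - {j}) = r - 1"
      using p(3) by simp
    ultimately have "card (fiber (collapse p)) = (r - 1) ^ (n - r) * (\<Prod>k\<in>{1..r} - {j}. lam k)"
      by (simp add: assms(1))
    moreover have "Lam = lam j * (\<Prod>k\<in>{1..r} - {j}. lam k)"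
      unfolding assms(8) using p(3) by (intro prod.remove) auto
    ultimately show ?thesis
      using lam_pos[OF p(3)] assms(4) by (simp add: p(1) of_nat_diff)
  qed
  have arcs: "real (\<Prod>p\<in>parcs \<Gamma>. card (fiber (collapse p))) =
      ((real r - 1) ^ (n - r) * real Lam) ^ rho r *
      (1 / (\<Prod>j=1..r. real (lam j) ^ in_degree (with_proj \<Gamma>) j))"
    if "\<Gamma> \<in> strong_tournaments r" for \<Gamma>
  proof -
    have R: "strong_semicomplete {1..r} (parcs \<Gamma>)" "card (parcs \<Gamma>) = rho r"
      using bij_betw_strong_tournaments[OF assms(4)] that by (auto dest: bij_betwE)
    note R' = arcs_strong_semicomplete[OF R(1)]
    have "real (\<Prod>p\<in>parcs \<Gamma>. card (fiber (collapse p))) =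
      (\<Prod>p\<in>parcs \<Gamma>. (real r - 1) ^ (n - r) * real Lam / real (lam (snd p)))"
      unfolding of_nat_prod using fiber[OF R(1)] by (intro prod.cong) auto
    also have "\<dots> = ((real r - 1) ^ (n - r) * real Lam) ^ rho r / (\<Prod>p\<in>parcs \<Gamma>. real (lam (snd p)))"
      by (simp add: prod_dividef R(2))
    also have "(\<Prod>p\<in>parcs \<Gamma>. real (lam (snd p))) =
      (\<Prod>j=1..r. \<Prod>p\<in>{p \<in> parcs \<Gamma>. snd p = j}. real (lam (snd p)))"
      using R' by (intro prod.group[symmetric]) auto
    also have "\<dots> = (\<Prod>j=1..r. real (lam j) ^ in_degree (with_proj \<Gamma>) j)"
      by (intro prod.cong) (auto simp: in_degree_def in_arcs_def)
    finally show ?thesis by simp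
  qed

  have "card {G. idem_generating_set a G \<and> card G = ?N + rho r} =
    card (band_parts \<times> singular_parts (rho r))"
    using bij_betw_same_card[OF bij_betw_minimal_generating_sets[OF min]]
    by (simp only: gen_iff card_K conj_assoc)
  also have "\<dots> = fact Lam * Stirling ?N Lam *
    (\<Sum>R | strong_semicomplete {1..r} R \<and> card R = rho r. \<Prod>p\<in>R. card (fiber (collapse p)))"
    using card_singular_parts[OF min] by (simp only: card_cartesian_product card_band_parts card_T card_K)
  also have "(\<Sum>R | strong_semicomplete {1..r} R \<and> card R = rho r. \<Prod>p\<in>R. card (fiber (collapse p))) =
    (\<Sum>\<Gamma>\<in>strong_tournaments r. \<Prod>p\<in>parcs \<Gamma>. card (fiber (collapse p)))"
    by (rule sum.reindex_bij_betw[OF bij_betw_strong_tournaments[OF assms(4)], symmetric])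
  finally have "real (card {G. idem_generating_set a G \<and> card G = ?N + rho r}) =
    fact Lam * real (Stirling ?N Lam) *
      (\<Sum>\<Gamma>\<in>strong_tournaments r. real (\<Prod>p\<in>parcs \<Gamma>. card (fiber (collapse p))))"
    by (simp only: of_nat_mult of_nat_fact of_nat_sum)
  also have "(\<Sum>\<Gamma>\<in>strong_tournaments r. real (\<Prod>p\<in>parcs \<Gamma>. card (fiber (collapse p)))) =
    ((real r - 1) ^ (n - r) * real Lam) ^ rho r *
      (\<Sum>\<Gamma>\<in>strong_tournaments r. 1 / (\<Prod>j=1..r. real (lam j) ^ in_degree (with_proj \<Gamma>) j))"
    unfolding sum_distrib_left using arcs by (intro sum.cong) auto
  finally have count: "real (card {G. idem_generating_set a G \<and> card G = ?N + rho r}) =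
    ((real r - 1) ^ (n - r) * real Lam) ^ rho r * fact Lam * real (Stirling ?N Lam) *
      (\<Sum>\<Gamma>\<in>strong_tournaments r. 1 / (\<Prod>j=1..r. real (lam j) ^ in_degree (with_proj \<Gamma>) j))"
    by (simp only: mult_ac)

  have "finite {R. strong_semicomplete {1..r} R \<and> card R = rho r}"
    by (rule finite_subset[of _ "Pow ({1..r} \<times> {1..r})"]) (auto simp: strong_semicomplete_def)
  then have "finite (strong_tournaments r)"
    using bij_betw_finite[OF bij_betw_strong_tournaments[OF assms(4)]] by blast
  then have "0 < (\<Sum>\<Gamma>\<in>strong_tournaments r. 1 / (\<Prod>j=1..r. real (lam j) ^ in_degree (with_proj \<Gamma>) j))"
    using strong_tournaments_nonempty[OF assms(4)] lam_pos
    by (intro sum_pos divide_pos_pos prod_pos zero_less_power) auto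
  moreover have "0 < Stirling ?N Lam"
    using card_transversals_le assms(4) Lam_pos by (intro Stirling_pos) (auto simp: card_T card_K)
  ultimately have "0 < real (card {G. idem_generating_set a G \<and> card G = ?N + rho r})"
    unfolding count using assms(4) Lam_pos by simp
  then have "{G. idem_generating_set a G \<and> card G = ?N + rho r} \<noteq> {}"
    by (metis card.empty less_irrefl of_nat_0)
  then show ?thesis
    using lower count by blast
qed

end
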